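(* Let $\mathrm{H}$ be a real Hilbert space. Let $(A,f) \in \mathcal{A}(\cdot,\mathrm{H}) \times \Gamma_0(\cdot,\mathrm{H})$ and $x \in \mathrm{H}$. If the following assertions are satisfied: (i) $A \in \mathcal{A}_{\mathrm{unif}}(\cdot,\mathrm{H})$; (ii) $A$ is semi-differentiable at $v := \mathrm{Prox}_{A,f}(0,x)$; (iii) $f$ is twice epi-differentiable at $v$ for $v_0 := x - A(0,v) \in \partial f(0,v)$; (iv) $d^2_e f(v|v_0) \in \Gamma_0(\mathrm{H})$; then $\mathrm{Prox}_{A,f}$ is proto-differentiable at $x$ for $v$ with $$D_p(\mathrm{Prox}_{A,f})(x|v) = \mathrm{prox}_{D_sA(v),\, d^2_e f(v|v_0)}.$$
   Context: Let $\mathrm{H}$ be a real Hilbert space with scalar product $\langle\cdot,\cdot\rangle$ and norm $\|\cdot\|$; $\mathbb{R}_+=[0,+\infty)$. Set limits (always as $\tau\to0$, $\tau>0$). For a family $(S_\tau)_{\tau>0}$ of subsets of a Hilbert space: $\limsup S_\tau$ (resp. $\mathrm{w}\text{-}\limsup S_\tau$) is the set of $x$ for which there exist positive $t_n\to0$ and $x_n\to x$ strongly (resp. weakly) with $x_n\in S_{t_n}$ for all $n$; $\liminf S_\tau$ is the set of $x$ such that for every positive sequence $t_n\to0$ there exist $x_n\to x$ strongly and $N$ with $x_n\in S_{t_n}$ for all $n\ge N$. The family is PK-convergent if $\limsup S_\tau\subset\liminf S_\tau$, and M-convergent (Mosco) if $\mathrm{w}\text{-}\limsup S_\tau\subset\liminf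 S_\tau$; in either case the limit is $\liminf S_\tau$. A family of set-valued maps $A_\tau:\mathrm{H}\rightrightarrows\mathrm{H}$ is G-convergent if the graphs $\mathrm{Gr}(A_\tau)=\{(x,y): y\in A_\tau(x)\}$ are PK-convergent in $\mathrm{H}\times\mathrm{H}$; its G-limit is the map whose graph is the limit. A family of functions $f_\tau:\mathrm{H}\to\mathbb{R}\cup\{\pm\infty\}$ is M-convergent if the epigraphs $\{(x,\lambda): f_\tau(x)\le\lambda\}$ are M-convergent in $\mathrm{H}\times\mathbb{R}$; its limit is the function whose epigraph is the limit. Single-valued maps are identified with set-valued maps whose values are singletons. $\Gamma_0(\mathrm{H})$ is the set of proper, lower semi-continuous, convex functions $\mathrm{H}\to\mathbb{R}\cup\{+\infty\}$, with subdifferential $\partial f(x)=\{y:\langle y,z-x\rangle\le f(z)-f(x)\ \forall z\in\mathrm{H}\}$. $\Gamma_0(\cdot,\mathrm{H})$ is the set of $f:\mathbb{R}_+\times\mathrm{H}\to\mathbb{R}\cup\{+\infty\}$ with $f(t,\cdot)\in\Gamma_0(\mathrm{H})$ for all $t\ge0$; $\partial f(t,x):=\partial(f(t,\cdot))(x)$ and $f^{-1}(\cdot,\mathbb{R}):=\{x\in\mathrm{H}: f(t,x)\in\mathbb{R}\ \forall t\ge0\}$. $\mathcal{A}(\mathrm{H})$ is the set of maps $A:\mathrm{H}\to\mathrm{H}$ that are Lipschitz continuous and strongly monotone ($\exists\alpha>0$: $\langle A(x_2)-A(x_1),x_2-x_1\rangle\ge\alpha\|x_2-x_1\|^2$ for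 all $x_1,x_2$). $\mathcal{A}(\cdot,\mathrm{H})$ is the set of $A:\mathbb{R}_+\times\mathrm{H}\to\mathrm{H}$ with $A(t,\cdot)\in\mathcal{A}(\mathrm{H})$ for all $t\ge0$. $\mathcal{A}_{\mathrm{unif}}(\cdot,\mathrm{H})$ is the set of those for which the Lipschitz constant $M\ge0$ and the strong monotonicity constant $\alpha>0$ can be chosen independently of $t\ge0$. For $(A,f)\in\mathcal{A}(\mathrm{H})\times\Gamma_0(\mathrm{H})$, $\mathrm{prox}_{A,f}:=(A+\partial f)^{-1}$; it is a single-valued map $\mathrm{H}\to\mathrm{H}$. For $(A,f)\in\mathcal{A}(\cdot,\mathrm{H})\times\Gamma_0(\cdot,\mathrm{H})$, $\mathrm{Prox}_{A,f}:\mathbb{R}_+\times\mathrm{H}\to\mathrm{H}$ is defined by $\mathrm{Prox}_{A,f}(t,x):=\mathrm{prox}_{A(t,\cdot),f(t,\cdot)}(x)$. Semi-differentiability: $A:\mathbb{R}_+\times\mathrm{H}\to\mathrm{H}$ is semi-differentiable at $x$ if for all $w\in\mathrm{H}$ the limit $D_sA(x)(w):=\lim_{\tau\to0^+,\,w'\to w}\frac{A(\tau,x+\tau w')-A(0,x)}{\tau}$ exists in $\mathrm{H}$; $D_sA(x):\mathrm{H}\to\mathrm{H}$ is the semi-derivative. (If $A\in\mathcal{A}_{\mathrm{unif}}(\cdot,\mathrm{H})$, then $D_sA(x)\in\mathcal{A}(\mathrm{H})$.) Proto-differentiability: for $A:\mathbb{R}_+\times\mathrm{H}\rightrightarrows\mathrm{H}$,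 $x\in\mathrm{H}$, $v\in A(0,x)$, put $\Delta_\tau A(x|v)(w):=\frac{A(\tau,x+\tau w)-v}{\tau}$. $A$ is proto-differentiable at $x$ for $v$ if $(\Delta_\tau A(x|v))_{\tau>0}$ is G-convergent; the G-limit is denoted $D_pA(x|v)$. Twice epi-differentiability: for $f\in\Gamma_0(\cdot,\mathrm{H})$, $x\in f^{-1}(\cdot,\mathbb{R})$, $v\in\partial f(0,x)$, put $\Delta^2_\tau f(x|v)(w):=\frac{f(\tau,x+\tau w)-f(\tau,x)-\tau\langle v,w\rangle}{\tau^2}$. $f$ is twice epi-differentiable at $x$ for $v$ if $(\Delta^2_\tau f(x|v))_{\tau>0}$ is M-convergent; the limit function is denoted $d^2_ef(x|v):\mathrm{H}\to\mathbb{R}\cup\{\pm\infty\}$. Saying that $f$ is twice epi-differentiable at $x$ for $v$ includes the requirement $x\in f^{-1}(\cdot,\mathbb{R})$. *)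

theory Defs
  imports "HOL-Analysis.Analysis"
begin

text \<open>A real Hilbert space is a type of sort \<open>{real_inner, complete_space}\<close>.  The time half-line
  is rendered by type \<^typ>\<open>real\<close>; only the times \<open>t \<ge> 0\<close> are ever constrained or used, so the values
  of time-dependent maps at negative times are irrelevant.\<close>


subsection \<open>Set limits as \<open>\<tau> \<rightarrow> 0\<close>, \<open>\<tau> > 0\<close>\<close>

definition weakly_tendsto :: "(nat \<Rightarrow> 'a::real_inner) \<Rightarrow> 'a \<Rightarrow> bool" where
  "weakly_tendsto X x \<longleftrightarrow> (\<forall>y. (\<lambda>n. inner (X n) y) \<longlonglongrightarrow> inner x y)"

definition set_limsup :: "(real \<Rightarrow> 'a::real_inner set) \<Rightarrow> 'a set" where
  "set_limsup S = {x. \<exists>t X. (\<forall>n. t n > 0) \<and> t \<longlonglongrightarrow> 0 \<and> X \<longlonglongrightarrow> x \<and> (\<forall>n::nat. X n \<in> S (t n))}"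

definition set_wlimsup :: "(real \<Rightarrow> 'a::real_inner set) \<Rightarrow> 'a set" where
  "set_wlimsup S =
     {x. \<exists>t X. (\<forall>n. t n > 0) \<and> t \<longlonglongrightarrow> 0 \<and> weakly_tendsto X x \<and> (\<forall>n::nat. X n \<in> S (t n))}"

definition set_liminf :: "(real \<Rightarrow> 'a::real_inner set) \<Rightarrow> 'a set" where
  "set_liminf S =
     {x. \<forall>t. (\<forall>n. t n > 0) \<and> t \<longlonglongrightarrow> 0 \<longrightarrow> (\<exists>X N. X \<longlonglongrightarrow> x \<and> (\<forall>n::nat\<ge>N. X n \<in> S (t n)))}"

definition PK_convergent :: "(real \<Rightarrow> 'a::real_inner set) \<Rightarrow> bool" where
  "PK_convergent S \<longleftrightarrow> set_limsup S \<subseteq> set_liminf S"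

definition M_convergent :: "(real \<Rightarrow> 'a::real_inner set) \<Rightarrow> bool" where
  "M_convergent S \<longleftrightarrow> set_wlimsup S \<subseteq> set_liminf S"


subsection \<open>G-convergence of set-valued maps and M-convergence of functions\<close>

definition graph_of :: "('a \<Rightarrow> 'b set) \<Rightarrow> ('a \<times> 'b) set" where
  "graph_of A = {(x, y). y \<in> A x}"

definition G_convergent :: "(real \<Rightarrow> 'a::real_inner \<Rightarrow> 'a set) \<Rightarrow> bool" where
  "G_convergent A \<longleftrightarrow> PK_convergent (\<lambda>\<tau>. graph_of (A \<tau>))"

definition G_lim :: "(real \<Rightarrow> 'a::real_inner \<Rightarrow> 'a set) \<Rightarrow> 'a \<Rightarrow> 'a set" where
  "G_lim A = (THE B. graph_of B = set_liminf (\<lambda>\<tau>. graph_of (A \<tau>)))"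

definition epi :: "('a \<Rightarrow> ereal) \<Rightarrow> ('a \<times> real) set" where
  "epi f = {(x, l). f x \<le> ereal l}"

definition fun_M_convergent :: "(real \<Rightarrow> 'a::real_inner \<Rightarrow> ereal) \<Rightarrow> bool" where
  "fun_M_convergent f \<longleftrightarrow> M_convergent (\<lambda>\<tau>. epi (f \<tau>))"

text \<open>The lower limit of a family of epigraphs is closed and stable under increasing the second
  component, hence it is the epigraph of a function, which is unique.\<close>

definition fun_M_lim :: "(real \<Rightarrow> 'a::real_inner \<Rightarrow> ereal) \<Rightarrow> 'a \<Rightarrow> ereal" where
  "fun_M_lim f = (THE g. epi g = set_liminf (\<lambda>\<tau>. epi (f \<tau>)))"


subsection \<open>Convex functions and subdifferentials\<close>

definition Gamma0 :: "('h::real_inner \<Rightarrow> ereal) set" where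
  "Gamma0 = {f.
     (\<forall>x. f x \<noteq> -\<infinity>) \<and> (\<exists>x. f x \<noteq> \<infinity>) \<and>
     (\<forall>x. f x \<le> Liminf (at x) f) \<and>
     (\<forall>x y. \<forall>s\<in>{0<..<1}.
        f ((1 - s) *\<^sub>R x + s *\<^sub>R y) \<le> ereal (1 - s) * f x + ereal s * f y)}"

definition Gamma0_time :: "(real \<Rightarrow> 'h::real_inner \<Rightarrow> ereal) set" where
  "Gamma0_time = {f. \<forall>t\<ge>0. f t \<in> Gamma0}"

text \<open>In \<^typ>\<open>ereal\<close> one has \<open>\<infinity> - \<infinity> = \<infinity>\<close>; for proper \<open>f\<close> with \<open>f x = \<infinity>\<close> the subdifferential at
  \<open>x\<close> is empty because of the points \<open>z\<close> where \<open>f z\<close> is finite.\<close>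

definition subdiff :: "('h::real_inner \<Rightarrow> ereal) \<Rightarrow> 'h \<Rightarrow> 'h set" where
  "subdiff f x = {y. \<forall>z. ereal (inner y (z - x)) \<le> f z - f x}"

definition finite_domain :: "(real \<Rightarrow> 'h::real_inner \<Rightarrow> ereal) \<Rightarrow> 'h set" where
  "finite_domain f = {x. \<forall>t\<ge>0. \<bar>f t x\<bar> \<noteq> \<infinity>}"


subsection \<open>Strongly monotone Lipschitz maps\<close>

definition strongly_monotone :: "real \<Rightarrow> ('h::real_inner \<Rightarrow> 'h) \<Rightarrow> bool" where
  "strongly_monotone \<alpha> A \<longleftrightarrow> \<alpha> > 0 \<and>
     (\<forall>x1 x2. inner (A x2 - A x1) (x2 - x1) \<ge> \<alpha> * (norm (x2 - x1))\<^sup>2)"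

definition Amaps :: "('h::real_inner \<Rightarrow> 'h) set" where
  "Amaps = {A. (\<exists>M. M-lipschitz_on UNIV A) \<and> (\<exists>\<alpha>. strongly_monotone \<alpha> A)}"

definition Amaps_time :: "(real \<Rightarrow> 'h::real_inner \<Rightarrow> 'h) set" where
  "Amaps_time = {A. \<forall>t\<ge>0. A t \<in> Amaps}"

definition Amaps_unif :: "(real \<Rightarrow> 'h::real_inner \<Rightarrow> 'h) set" where
  "Amaps_unif = {A \<in> Amaps_time. \<exists>M \<alpha>. \<forall>t\<ge>0. M-lipschitz_on UNIV (A t) \<and> strongly_monotone \<alpha> (A t)}"


subsection \<open>Generalized proximity operators\<close>

definition sv_inverse :: "('a \<Rightarrow> 'b set) \<Rightarrow> 'b \<Rightarrow> 'a set" where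
  "sv_inverse A y = {x. y \<in> A x}"

definition prox_set :: "('h::real_inner \<Rightarrow> 'h) \<Rightarrow> ('h \<Rightarrow> ereal) \<Rightarrow> 'h \<Rightarrow> 'h set" where
  "prox_set A f = sv_inverse (\<lambda>y. {A y + p | p. p \<in> subdiff f y})"

text \<open>For \<open>A \<in> Amaps\<close> and \<open>f \<in> Gamma0\<close> on a Hilbert space all values of \<open>prox_set A f\<close> are
  singletons.\<close>

definition prox :: "('h::real_inner \<Rightarrow> 'h) \<Rightarrow> ('h \<Rightarrow> ereal) \<Rightarrow> 'h \<Rightarrow> 'h" where
  "prox A f x = (THE y. y \<in> prox_set A f x)"

definition Prox :: "(real \<Rightarrow> 'h::real_inner \<Rightarrow> 'h) \<Rightarrow> (real \<Rightarrow> 'h \<Rightarrow> ereal) \<Rightarrow> real \<Rightarrow> 'h \<Rightarrow> 'h" where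
  "Prox A f t x = prox (A t) (f t) x"


subsection \<open>Generalized derivatives of time-dependent maps and functions\<close>

text \<open>In the joint limit \<open>\<tau> \<rightarrow> 0\<^sup>+\<close>, \<open>w' \<rightarrow> w\<close>, the value \<open>w' = w\<close> is allowed.\<close>

definition semi_quotient :: "(real \<Rightarrow> 'h::real_inner \<Rightarrow> 'h) \<Rightarrow> 'h \<Rightarrow> real \<times> 'h \<Rightarrow> 'h" where
  "semi_quotient A x = (\<lambda>(\<tau>, w'). (A \<tau> (x + \<tau> *\<^sub>R w') - A 0 x) /\<^sub>R \<tau>)"

definition semi_differentiable :: "(real \<Rightarrow> 'h::real_inner \<Rightarrow> 'h) \<Rightarrow> 'h \<Rightarrow> bool" where
  "semi_differentiable A x \<longleftrightarrow>
     (\<forall>w. \<exists>L. (semi_quotient A x \<longlongrightarrow> L) (at_right 0 \<times>\<^sub>F nhds w))"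

definition semi_derivative :: "(real \<Rightarrow> 'h::real_inner \<Rightarrow> 'h) \<Rightarrow> 'h \<Rightarrow> 'h \<Rightarrow> 'h" where
  "semi_derivative A x w = Lim (at_right 0 \<times>\<^sub>F nhds w) (semi_quotient A x)"

definition proto_quotient ::
    "(real \<Rightarrow> 'h::real_inner \<Rightarrow> 'h set) \<Rightarrow> 'h \<Rightarrow> 'h \<Rightarrow> real \<Rightarrow> 'h \<Rightarrow> 'h set" where
  "proto_quotient A x v \<tau> w = (\<lambda>y. (y - v) /\<^sub>R \<tau>) ` A \<tau> (x + \<tau> *\<^sub>R w)"

definition proto_differentiable ::
    "(real \<Rightarrow> 'h::real_inner \<Rightarrow> 'h set) \<Rightarrow> 'h \<Rightarrow> 'h \<Rightarrow> bool" where
  "proto_differentiable A x v \<longleftrightarrow> v \<in> A 0 x \<and> G_convergent (proto_quotient A x v)"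

definition proto_derivative ::
    "(real \<Rightarrow> 'h::real_inner \<Rightarrow> 'h set) \<Rightarrow> 'h \<Rightarrow> 'h \<Rightarrow> 'h \<Rightarrow> 'h set" where
  "proto_derivative A x v = G_lim (proto_quotient A x v)"

definition epi_quotient ::
    "(real \<Rightarrow> 'h::real_inner \<Rightarrow> ereal) \<Rightarrow> 'h \<Rightarrow> 'h \<Rightarrow> real \<Rightarrow> 'h \<Rightarrow> ereal" where
  "epi_quotient f x v \<tau> w =
     (f \<tau> (x + \<tau> *\<^sub>R w) - f \<tau> x - ereal (\<tau> * inner v w)) / ereal (\<tau>\<^sup>2)"

definition twice_epi_differentiable ::
    "(real \<Rightarrow> 'h::real_inner \<Rightarrow> ereal) \<Rightarrow> 'h \<Rightarrow> 'h \<Rightarrow> bool" where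
  "twice_epi_differentiable f x v \<longleftrightarrow>
     x \<in> finite_domain f \<and> v \<in> subdiff (f 0) x \<and> fun_M_convergent (epi_quotient f x v)"

definition epi_derivative2 ::
    "(real \<Rightarrow> 'h::real_inner \<Rightarrow> ereal) \<Rightarrow> 'h \<Rightarrow> 'h \<Rightarrow> 'h \<Rightarrow> ereal" where
  "epi_derivative2 f x v = fun_M_lim (epi_quotient f x v)"

definition sv :: "('a \<Rightarrow> 'b) \<Rightarrow> 'a \<Rightarrow> 'b set" where
  "sv F x = {F x}"

end

theory Submission
  imports Defs
begin

text \<open>Write \<open>\<phi>\<^sub>\<tau>\<close> for the second-order difference quotient of \<open>f\<close> at \<open>v\<close> for \<open>v\<^sub>0\<close> and \<open>A\<^sub>\<tau>\<close> for the
  difference quotient of \<open>A\<close> at \<open>v\<close>.  Rescaling shows that the difference quotient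
  \<open>z = (Prox A f \<tau> (x + \<tau> w) - v) / \<tau>\<close> solves \<open>w - A\<^sub>\<tau> z \<in> \<partial>\<phi>\<^sub>\<tau> z\<close>.  So it suffices that solutions of
  such inclusions converge when \<open>\<phi>\<^sub>\<tau>\<close> Mosco converges and \<open>A\<^sub>\<tau>\<close>, uniformly strongly monotone,
  converges continuously: since \<open>\<phi>\<^sub>\<tau> 0 = 0\<close> and the limit is proper, the \<open>\<phi>\<^sub>\<tau>\<close> have a common minorant
  of linear growth, hence the solutions are bounded; along a weakly convergent subsequence the
  Mosco lower bound and strong monotonicity, tested against a recovery sequence of the limit
  solution, force strong convergence.

  Convex functions are handled through their epigraphs, which keeps extended reals out of the
  estimates.\<close>

subsection \<open>Strongly convex minimisation over an epigraph\<close>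

text \<open>Divide by \<open>s\<close> and let \<open>s\<close> tend to 0 from the right. This
  extracts first-order conditions from minimality along segments.\<close>

lemma nonneg_if_quadratic_nonneg:
  fixes a b :: real
  assumes "\<And>s. 0 < s \<Longrightarrow> s < 1 \<Longrightarrow> 0 \<le> s * a + s\<^sup>2 * b"
  shows "0 \<le> a"
proof -
  have "((\<lambda>s. a + s * b) \<longlongrightarrow> a + 0 * b) (at_right 0)"
    by (intro tendsto_intros)
  moreover have "\<forall>\<^sub>F s in at_right (0::real). 0 \<le> a + s * b"
    using eventually_at_right_real[OF zero_less_one]
  proof eventually_elim
    case (elim s)
    then have "0 \<le> s * (a + s * b)"
      using assms[of s] by (simp add: algebra_simps power2_eq_square)
    with elim show ?case by (auto simp: zero_le_mult_iff)
  qed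
  ultimately show ?thesis
    using tendsto_lowerbound[of "\<lambda>s. a + s * b" a "at_right 0" 0] by simp
qed

text \<open>The pair \<open>(p, l)\<close> minimises \<open>m + c/2 * |y - w|^2\<close> over
  \<open>E\<close>. The linear minorant bounds this from below, the parallelogram law makes
  minimising sequences Cauchy, and the claim is the first-order condition at the minimum.\<close>

lemma variational_minimizer:
  fixes E :: "('h::{real_inner,complete_space} \<times> real) set"
  assumes "closed E" "convex E" "E \<noteq> {}" "c > 0" "K \<ge> 0"
    and minorant: "\<And>y m. (y, m) \<in> E \<Longrightarrow> - K * (1 + norm y) \<le> m"
  obtains p l where "(p, l) \<in> E" "\<And>y m. (y, m) \<in> E \<Longrightarrow> c * inner (w - p) (y - p) \<le> m - l"
proof -
  define J where "J = (\<lambda>(y, m). m + c / 2 * (norm (y - w))\<^sup>2)"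
  define I where "I = Inf (J ` E)"
  have J: "J (y, m) = m + c / 2 * (norm (y - w))\<^sup>2" for y m
    by (simp add: J_def)
  have J_lower: "- K * (1 + norm w) - K\<^sup>2 / (2 * c) \<le> J (y, m)" if "(y, m) \<in> E" for y m
  proof -
    have "K * norm y \<le> K * (norm w + norm (y - w))"
      using \<open>K \<ge> 0\<close> norm_triangle_sub[of y w] by (intro mult_left_mono) auto
    \<comment> \<open>Completing the square: the quadratic term absorbs the linear loss up to a
      constant.\<close>
    moreover have "0 \<le> (c * norm (y - w) - K)\<^sup>2 / (2 * c)"
      using \<open>c > 0\<close> by simp
    then have "K * norm (y - w) - K\<^sup>2 / (2 * c) \<le> c / 2 * (norm (y - w))\<^sup>2"
      using \<open>c > 0\<close> by (simp add: field_simps power2_eq_square)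
    ultimately show ?thesis
      using minorant[OF that] unfolding J by (simp add: algebra_simps)
  qed
  have bdd: "bdd_below (J ` E)"
    using J_lower by (intro bdd_belowI[where m = "- K * (1 + norm w) - K\<^sup>2 / (2 * c)"]) auto
  have I_le: "I \<le> J (y, m)" if "(y, m) \<in> E" for y m
    unfolding I_def using bdd that by (intro cInf_lower) auto
  have "\<exists>e\<in>E. J e < I + 1 / Suc n" for n
  proof -
    have "\<exists>j\<in>J ` E. j < I + 1 / Suc n"
      using cInf_less_iff[of "J ` E" "I + 1 / Suc n"] \<open>E \<noteq> {}\<close> bdd unfolding I_def[symmetric] by simp
    then show ?thesis by auto
  qed
  then obtain e where e: "e n \<in> E" "J (e n) < I + 1 / Suc n" for n
    by metis
  define y m where "y = fst \<circ> e" and "m = snd \<circ> e"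
  have ym: "(y n, m n) \<in> E" "J (y n, m n) < I + 1 / Suc n" for n
    using e by (simp_all add: y_def m_def)
  \<comment> \<open>The midpoint lies in \<open>E\<close>, so its value is at least
    \<open>I\<close>; by the parallelogram law that value is below the mean of the two values by
    \<open>c/8 * |y i - y j|^2\<close>.\<close>
  have near: "(norm (y i - y j))\<^sup>2 \<le> 4 / c * (1 / Suc i + 1 / Suc j)" for i j
  proof -
    have "((1/2) *\<^sub>R y i + (1/2) *\<^sub>R y j, (1/2) * m i + (1/2) * m j) \<in> E"
      using convexD[OF \<open>convex E\<close> ym(1)[of i] ym(1)[of j], of "1/2" "1/2"] by simp
    from I_le[OF this]
    have "I \<le> (1/2) * m i + (1/2) * m j + c / 2 * (norm ((1/2) *\<^sub>R y i + (1/2) *\<^sub>R y j - w))\<^sup>2"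
      by (simp add: J)
    moreover have "(norm ((1/2) *\<^sub>R y i + (1/2) *\<^sub>R y j - w))\<^sup>2 =
        (norm (y i - w))\<^sup>2 / 2 + (norm (y j - w))\<^sup>2 / 2 - (norm (y i - y j))\<^sup>2 / 4"
      by (simp add: power2_norm_eq_inner inner_add_left inner_add_right inner_diff_left
          inner_diff_right inner_commute) (simp add: field_simps)
    ultimately have "I \<le> (J (y i, m i) + J (y j, m j)) / 2 - c / 8 * (norm (y i - y j))\<^sup>2"
      by (simp add: J algebra_simps add_divide_distrib)
    moreover have "t \<le> (a + b) / 2" if "u < I + a" "u' < I + b" "I \<le> (u + u') / 2 - t"
      for a b t u u' :: real
      using that by (simp add: field_simps)
    ultimately have "c / 8 * (norm (y i - y j))\<^sup>2 \<le> (1 / Suc i + 1 / Suc j) / 2"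
      using ym(2) by blast
    moreover have "d \<le> 4 / c * a" if "c / 8 * d \<le> a / 2" for a d :: real
      using that \<open>c > 0\<close> by (simp add: field_simps)
    ultimately show ?thesis by blast
  qed
  have "Cauchy y"
  proof (rule metric_CauchyI)
    fix \<epsilon> :: real
    assume "\<epsilon> > 0"
    have "(\<lambda>n. 4 / c * (1 / Suc n + 1 / Suc n)) \<longlonglongrightarrow> 4 / c * (0 + 0)"
      by (intro tendsto_intros LIMSEQ_Suc lim_1_over_n)
    then have "\<forall>\<^sub>F n in sequentially. 4 / c * (1 / Suc n + 1 / Suc n) < \<epsilon>\<^sup>2"
      using \<open>\<epsilon> > 0\<close> by (intro order_tendstoD) auto
    then obtain N where N: "4 / c * (1 / Suc N + 1 / Suc N) < \<epsilon>\<^sup>2"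
      by (auto simp: eventually_sequentially)
    have "dist (y i) (y j) < \<epsilon>" if "N \<le> i" "N \<le> j" for i j
    proof -
      have "1 / real (Suc i) + 1 / Suc j \<le> 1 / Suc N + 1 / Suc N"
        using that by (intro add_mono divide_left_mono) auto
      then have "4 / c * (1 / Suc i + 1 / Suc j) \<le> 4 / c * (1 / Suc N + 1 / Suc N)"
        using \<open>c > 0\<close> by (intro mult_left_mono) auto
      with near[of i j] N have "(norm (y i - y j))\<^sup>2 < \<epsilon>\<^sup>2" by linarith
      with \<open>\<epsilon> > 0\<close> show ?thesis by (simp add: dist_norm power2_less_imp_less)
    qed
    then show "\<exists>M. \<forall>i\<ge>M. \<forall>j\<ge>M. dist (y i) (y j) < \<epsilon>" by blast
  qed
  then obtain p where p: "y \<longlonglongrightarrow> p"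
    by (auto simp: Cauchy_convergent_iff convergent_def)
  \<comment> \<open>Heights need not form a Cauchy sequence a priori; their limit is recovered from
    that of \<open>J\<close> by subtracting the convergent quadratic term.\<close>
  have "(\<lambda>n. J (y n, m n)) \<longlonglongrightarrow> I"
  proof (rule tendsto_sandwich[where f = "\<lambda>_. I"])
    show "(\<lambda>n. I + 1 / Suc n) \<longlonglongrightarrow> I"
      using tendsto_add[OF tendsto_const LIMSEQ_Suc[OF lim_1_over_n], of I] by simp
  qed (use I_le ym in \<open>auto intro!: always_eventually intro: less_imp_le simp del: of_nat_Suc\<close>)
  then have "(\<lambda>n. J (y n, m n) - c / 2 * (norm (y n - w))\<^sup>2) \<longlonglongrightarrow> I - c / 2 * (norm (p - w))\<^sup>2"
    by (intro tendsto_intros p)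
  then have lim: "m \<longlonglongrightarrow> I - c / 2 * (norm (p - w))\<^sup>2"
    by (simp add: J)
  define l where "l = I - c / 2 * (norm (p - w))\<^sup>2"
  have pl: "(p, l) \<in> E"
    using closed_sequentially[OF \<open>closed E\<close>, of "\<lambda>n. (y n, m n)" "(p, l)"] ym(1)
      tendsto_Pair[OF p lim] by (simp add: l_def)
  show ?thesis
  proof
    show "(p, l) \<in> E" by (fact pl)
    fix y m
    assume "(y, m) \<in> E"
    \<comment> \<open>Compare the minimum with the points of the segment from \<open>(p, l)\<close>
      to \<open>(y, m)\<close>.\<close>
    have "0 \<le> (m - l) - c * inner (w - p) (y - p)"
    proof (rule nonneg_if_quadratic_nonneg)
      fix s :: real
      assume s: "0 < s" "s < 1"
      have "((1 - s) *\<^sub>R p + s *\<^sub>R y, (1 - s) * l + s * m) \<in> E"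
        using convexD[OF \<open>convex E\<close> pl \<open>(y, m) \<in> E\<close>, of "1 - s" s] s by simp
      from I_le[OF this]
      have "l + c / 2 * (norm (p - w))\<^sup>2 \<le>
          (1 - s) * l + s * m + c / 2 * (norm ((p - w) + s *\<^sub>R (y - p)))\<^sup>2"
        by (simp add: J l_def algebra_simps)
      moreover have "(norm ((p - w) + s *\<^sub>R (y - p)))\<^sup>2 =
          (norm (p - w))\<^sup>2 - 2 * s * inner (w - p) (y - p) + s\<^sup>2 * (norm (y - p))\<^sup>2"
        unfolding power2_norm_eq_inner
        by (simp add: algebra_simps inner_commute power2_eq_square)
      ultimately have "l + c / 2 * (norm (p - w))\<^sup>2 \<le> (1 - s) * l + s * m + c / 2 *
          ((norm (p - w))\<^sup>2 - 2 * s * inner (w - p) (y - p) + s\<^sup>2 * (norm (y - p))\<^sup>2)"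
        by simp
      moreover have "0 \<le> s * ((m - l) - c * i) + s\<^sup>2 * (c / 2 * b)"
        if "l + c / 2 * a \<le> (1 - s) * l + s * m + c / 2 * (a - 2 * s * i + s\<^sup>2 * b)" for a b i
        using that by (simp add: algebra_simps)
      ultimately show "0 \<le> s * ((m - l) - c * inner (w - p) (y - p)) + s\<^sup>2 * (c / 2 * (norm (y - p))\<^sup>2)"
        by blast
    qed
    then show "c * inner (w - p) (y - p) \<le> m - l" by simp
  qed
qed

subsection \<open>Weak sequential compactness of balls\<close>

text \<open>The representing vector minimises \<open>|y|^2 / 2 - L y\<close> over \<open>V\<close>:
  apply \<open>variational_minimizer\<close> to the graph of \<open>- L\<close>. The functional is
  linear only on \<open>V\<close>, as happens for a limit of functionals that exists only
  there.\<close>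

lemma riesz_on_closed_subspace:
  fixes V :: "'h::{real_inner,complete_space} set"
  assumes "subspace V" "closed V"
    and add: "\<And>y z. y \<in> V \<Longrightarrow> z \<in> V \<Longrightarrow> L (y + z) = L y + L z"
    and scale: "\<And>c y. y \<in> V \<Longrightarrow> L (c *\<^sub>R y) = c * L y"
    and bound: "\<And>y. y \<in> V \<Longrightarrow> \<bar>L y\<bar> \<le> K * norm y"
  obtains p where "p \<in> V" "\<And>y. y \<in> V \<Longrightarrow> L y = inner p y"
proof -
  define E where "E = {(y, - L y) | y. y \<in> V}"
  have diff: "L (y - z) = L y - L z" if "y \<in> V" "z \<in> V" for y z
    using add[of y "(-1) *\<^sub>R z"] scale[of z "-1"] subspace_scale[OF \<open>subspace V\<close> that(2), of "-1"] that
    by simp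
  have bound': "\<bar>L y\<bar> \<le> \<bar>K\<bar> * norm y" if "y \<in> V" for y
    using bound[OF that] by (meson abs_ge_self mult_right_mono norm_ge_zero order_trans)
  have "closed E"
    unfolding closed_sequential_limits
  proof (intro allI impI, elim conjE)
    fix e and a
    assume e: "\<forall>n. e n \<in> E" and "e \<longlonglongrightarrow> a"
    have fst: "(\<lambda>n. fst (e n)) \<longlonglongrightarrow> fst a" and snd: "(\<lambda>n. snd (e n)) \<longlonglongrightarrow> snd a"
      using \<open>e \<longlonglongrightarrow> a\<close> by (auto intro: tendsto_fst tendsto_snd)
    have eV: "fst (e n) \<in> V" "snd (e n) = - L (fst (e n))" for n
      using e by (auto simp: E_def dest!: spec[of _ n])
    have aV: "fst a \<in> V"
      using closed_sequentially[OF \<open>closed V\<close> _ fst] eV by auto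
    have "(\<lambda>n. L (fst (e n)) - L (fst a)) \<longlonglongrightarrow> 0"
    proof (rule Lim_null_comparison)
      show "\<forall>\<^sub>F n in sequentially. norm (L (fst (e n)) - L (fst a)) \<le> \<bar>K\<bar> * norm (fst (e n) - fst a)"
        using bound' aV eV by (simp flip: diff add: subspace_diff[OF \<open>subspace V\<close>])
      show "(\<lambda>n. \<bar>K\<bar> * norm (fst (e n) - fst a)) \<longlonglongrightarrow> 0"
        using tendsto_mult_right_zero[OF tendsto_norm_zero[OF LIM_zero[OF fst]]] by simp
    qed
    then have "(\<lambda>n. - L (fst (e n))) \<longlonglongrightarrow> - L (fst a)"
      by (intro tendsto_minus) (rule LIM_zero_cancel)
    then have "snd a = - L (fst a)"
      using snd eV(2) LIMSEQ_unique by auto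
    with aV show "a \<in> E" by (cases a) (auto simp: E_def)
  qed
  moreover have "convex E"
    using subspace_imp_convex[OF \<open>subspace V\<close>]
    by (auto simp: E_def convex_def add scale subspace_scale[OF \<open>subspace V\<close>] algebra_simps)
  moreover have "E \<noteq> {}"
    using subspace_0[OF \<open>subspace V\<close>] by (auto simp: E_def)
  moreover have "- \<bar>K\<bar> * (1 + norm y) \<le> m" if "(y, m) \<in> E" for y m
    using that bound'[of y] by (auto simp: E_def algebra_simps)
  ultimately obtain p l where pl: "(p, l) \<in> E"
    and var: "\<And>y m. (y, m) \<in> E \<Longrightarrow> 1 * inner (0 - p) (y - p) \<le> m - l"
    using variational_minimizer[of E 1 "\<bar>K\<bar>" 0] by (metis abs_ge_zero zero_less_one)
  have p: "p \<in> V" "l = - L p" using pl by (auto simp: E_def)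
  \<comment> \<open>Since \<open>V\<close> is a subspace, \<open>p + u\<close> is admissible for
    every \<open>u\<close> in \<open>V\<close>; using \<open>- u\<close> as well turns the
    inequality into equality.\<close>
  have le: "L u \<le> inner p u" if "u \<in> V" for u
    using var[of "p + u" "- L (p + u)"] that p
    by (auto simp: E_def add subspace_add[OF \<open>subspace V\<close>])
  have "L y = inner p y" if "y \<in> V" for y
    using le[OF that] le[of "(-1) *\<^sub>R y"] that scale[OF that, of "-1"]
      subspace_scale[OF \<open>subspace V\<close> that, of "-1"] by simp
  with p(1) show ?thesis by (rule that)
qed

text \<open>Extract a subsequence whose inner products with every \<open>X m\<close> converge.
  Convergence then holds on a closed subspace \<open>V\<close> containing all \<open>X m\<close>,
  Riesz represents the limit functional on \<open>V\<close>, and other test vectors are projected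
  onto \<open>V\<close>.\<close>

lemma bounded_imp_weakly_convergent_subseq:
  fixes X :: "nat \<Rightarrow> 'h::{real_inner,complete_space}"
  assumes X: "\<And>n. norm (X n) \<le> R"
  obtains p s where "strict_mono s" "weakly_tendsto (X \<circ> s) p"
proof -
  have "R \<ge> 0" using X[of 0] norm_ge_zero order_trans by blast
  \<comment> \<open>Tychonoff replaces the diagonal argument: the Gram rows
    \<open>m \<mapsto> inner (X n) (X m)\<close> live in a compact product, which is sequentially
    compact because the countable product is metrizable.\<close>
  have "compact (Pi\<^sub>E UNIV (\<lambda>m::nat. {- (R * R)..R * R}))"
    using compactin_PiE[of "\<lambda>_. euclidean" UNIV "\<lambda>m::nat. {- (R * R)..R * R}"]
    by (simp add: euclidean_product_topology)
  moreover have "(\<lambda>m. inner (X n) (X m)) \<in> Pi\<^sub>E UNIV (\<lambda>m::nat. {- (R * R)..R * R})" for n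
  proof -
    have "\<bar>inner (X n) (X m)\<bar> \<le> R * R" for m
      using Cauchy_Schwarz_ineq2[of "X n" "X m"] mult_mono[OF X X \<open>R \<ge> 0\<close> norm_ge_zero] order_trans
      by blast
    then show ?thesis by (auto simp: abs_le_iff) (smt (verit))
  qed
  ultimately obtain g s where s: "strict_mono s"
    and g: "((\<lambda>n. (\<lambda>m. inner (X n) (X m))) \<circ> s) \<longlonglongrightarrow> g"
    unfolding compact_eq_seq_compact_metric seq_compact_def by metis
  have gm: "(\<lambda>n. inner (X (s n)) (X m)) \<longlonglongrightarrow> g m" for m
    using continuous_on_tendsto_compose[OF continuous_on_product_coordinates[of m] g] by (simp add: o_def)
  define V where "V = {y. convergent (\<lambda>n. inner (X (s n)) y)}"
  define L where "L y = lim (\<lambda>n. inner (X (s n)) y)" for y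
  have L: "(\<lambda>n. inner (X (s n)) y) \<longlonglongrightarrow> L y" if "y \<in> V" for y
    using that by (simp add: V_def L_def convergent_LIMSEQ_iff)
  have XV: "X m \<in> V" for m
    using gm by (auto simp: V_def convergent_def)
  have sub: "subspace V"
    unfolding subspace_def V_def
    by (auto simp: inner_add_right intro: convergent_add convergent_mult convergent_const)
  have closed: "closed V"
    unfolding closed_sequential_limits
  proof (intro allI impI, elim conjE)
    fix u a
    assume u: "\<forall>n. u n \<in> V" and "u \<longlonglongrightarrow> a"
    have "Cauchy (\<lambda>n. inner (X (s n)) a)"
    proof (rule metric_CauchyI)
      fix \<epsilon> :: real
      assume "\<epsilon> > 0"
      \<comment> \<open>Using \<open>R + 1\<close> keeps the divisor positive when
        \<open>R = 0\<close>.\<close>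
      then have "\<epsilon> / (3 * (R + 1)) > 0" using \<open>R \<ge> 0\<close> by simp
      with \<open>u \<longlonglongrightarrow> a\<close> obtain k where k: "norm (u k - a) < \<epsilon> / (3 * (R + 1))"
        by (auto simp: LIMSEQ_def dist_norm)
      have small: "\<bar>inner (X i) (a - u k)\<bar> < \<epsilon> / 3" for i
      proof -
        have "\<bar>inner (X i) (a - u k)\<bar> \<le> norm (X i) * norm (u k - a)"
          using Cauchy_Schwarz_ineq2[of "X i" "a - u k"] by (simp add: norm_minus_commute)
        also have "\<dots> \<le> (R + 1) * norm (u k - a)"
          using X[of i] by (intro mult_right_mono) auto
        also have "\<dots> < (R + 1) * (\<epsilon> / (3 * (R + 1)))"
          using k \<open>R \<ge> 0\<close> by (intro mult_strict_left_mono) auto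
        also have "\<dots> = \<epsilon> / 3"
          using \<open>R \<ge> 0\<close> by (simp add: divide_simps)
        finally show ?thesis .
      qed
      have "Cauchy (\<lambda>n. inner (X (s n)) (u k))"
        using u by (simp add: V_def Cauchy_convergent_iff)
      then obtain N where N: "\<bar>inner (X (s i)) (u k) - inner (X (s j)) (u k)\<bar> < \<epsilon> / 3"
        if "N \<le> i" "N \<le> j" for i j
        using \<open>\<epsilon> > 0\<close> unfolding Cauchy_def dist_real_def by (metis divide_pos_pos zero_less_numeral)
      have "dist (inner (X (s i)) a) (inner (X (s j)) a) < \<epsilon>" if "N \<le> i" "N \<le> j" for i j
        using N[OF that] small[of "s i"] small[of "s j"]
        unfolding dist_real_def inner_diff_right by linarith
      then show "\<exists>M. \<forall>i\<ge>M. \<forall>j\<ge>M. dist (inner (X (s i)) a) (inner (X (s j)) a) < \<epsilon>"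
        by blast
    qed
    then show "a \<in> V" by (simp add: V_def Cauchy_convergent_iff)
  qed
  have L_add: "L (y + z) = L y + L z" if "y \<in> V" "z \<in> V" for y z
    using tendsto_add[OF L[OF that(1)] L[OF that(2)]] L[of "y + z"] subspace_add[OF sub that]
    by (simp add: inner_add_right LIMSEQ_unique)
  have L_scale: "L (c *\<^sub>R y) = c * L y" if "y \<in> V" for c y
    using tendsto_mult[OF tendsto_const L[OF that], of c] L[of "c *\<^sub>R y"] subspace_scale[OF sub that]
    by (simp add: LIMSEQ_unique)
  have L_bound: "\<bar>L y\<bar> \<le> R * norm y" if "y \<in> V" for y
  proof (rule tendsto_upperbound[OF tendsto_rabs[OF L[OF that]]])
    show "\<forall>\<^sub>F n in sequentially. \<bar>inner (X (s n)) y\<bar> \<le> R * norm y"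
      by (intro always_eventually allI order_trans[OF Cauchy_Schwarz_ineq2] mult_right_mono X) simp
  qed simp
  obtain p where p: "p \<in> V" "\<And>y. y \<in> V \<Longrightarrow> L y = inner p y"
    using riesz_on_closed_subspace[OF sub closed L_add L_scale L_bound] by metis
  have "(\<lambda>n. inner (X (s n)) y) \<longlonglongrightarrow> inner p y" for y
  proof -
    \<comment> \<open>\<open>q\<close> is the orthogonal projection of \<open>y\<close> onto \<open>V\<close>, and all terms and \<open>p\<close> lie in \<open>V\<close>.\<close>
    obtain q where q: "q \<in> V" "\<And>z. z \<in> V \<Longrightarrow> inner y z = inner q z"
      using riesz_on_closed_subspace[OF sub closed, of "inner y" "norm y"]
      by (auto simp: inner_add_right Cauchy_Schwarz_ineq2)
    have "inner z y = inner z q" if "z \<in> V" for z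
      using q(2)[OF that] by (simp add: inner_commute)
    then show ?thesis
      using L[OF q(1)] p(2)[OF q(1)] p(1) XV by simp
  qed
  with s show ?thesis
    by (intro that) (auto simp: weakly_tendsto_def)
qed

subsection \<open>Supporting functionals of epigraphs and proximity operators\<close>

text \<open>For an epigraph of a function in \<open>Gamma0\<close> this encodes that
  \<open>q\<close> is a subgradient at \<open>p\<close> and \<open>l\<close> the value there, in
  real arithmetic only.\<close>

definition supports :: "('h::real_inner \<times> real) set \<Rightarrow> 'h \<Rightarrow> 'h \<Rightarrow> real \<Rightarrow> bool" where
  "supports E q p l \<longleftrightarrow> (p, l) \<in> E \<and> (\<forall>y m. (y, m) \<in> E \<longrightarrow> inner q (y - p) \<le> m - l)"

lemma supports_monotone:
  assumes "supports E q p l" "supports E q' p' l'"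
  shows "0 \<le> inner (q - q') (p - p')"
proof -
  have "inner q (p' - p) \<le> l' - l" "inner q' (p - p') \<le> l - l'"
    using assms by (auto simp: supports_def)
  then show ?thesis by (simp add: inner_diff_left inner_diff_right)
qed

section \<open>Epigraphs of proper lower semicontinuous convex functions\<close>

lemma mem_epi_iff [simp]: "(x, l) \<in> epi f \<longleftrightarrow> f x \<le> ereal l"
  by (simp add: epi_def)

lemma Gamma0_finite:
  assumes "f \<in> Gamma0"
  obtains x l where "f x = ereal l"
proof -
  obtain x where "f x \<noteq> \<infinity>" "f x \<noteq> -\<infinity>"
    using assms by (auto simp: Gamma0_def)
  then show ?thesis using that by (cases "f x") auto
qed

lemma closed_epi_Gamma0:
  assumes "f \<in> Gamma0"
  shows "closed (epi f)"
  unfolding closed_sequential_limits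
proof (intro allI impI, elim conjE)
  fix e and a
  assume e: "\<forall>n. e n \<in> epi f" and "e \<longlonglongrightarrow> a"
  obtain x l where a: "a = (x, l)" by fastforce
  have lim: "(\<lambda>n. fst (e n)) \<longlonglongrightarrow> x" "(\<lambda>n. snd (e n)) \<longlonglongrightarrow> l"
    using tendsto_fst[OF \<open>e \<longlonglongrightarrow> a\<close>] tendsto_snd[OF \<open>e \<longlonglongrightarrow> a\<close>] by (simp_all add: a)
  have "f x \<le> ereal l"
  proof (rule ccontr)
    assume "\<not> f x \<le> ereal l"
    then obtain c where c: "l < c" "ereal c < f x"
      using ereal_dense2[of "ereal l" "f x"] by (auto simp: not_le)
    have "f x \<le> Liminf (at x) f"
      using assms by (simp add: Gamma0_def)
    with c have "\<forall>\<^sub>F y in at x. ereal c < f y"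
      by (intro less_LiminfD) auto
    then have "\<forall>\<^sub>F y in nhds x. y \<noteq> x \<longrightarrow> ereal c < f y"
      by (simp add: eventually_at_filter)
    \<comment> \<open>The filter \<open>at x\<close> omits \<open>x\<close> itself, where the bound
      holds by the choice of \<open>c\<close>.\<close>
    then have "\<forall>\<^sub>F y in nhds x. ereal c < f y"
    proof eventually_elim
      case (elim y)
      then show ?case using c(2) by (cases "y = x") auto
    qed
    then have "\<forall>\<^sub>F n in sequentially. ereal c < f (fst (e n))"
      using lim(1) by (rule eventually_compose_filterlim)
    moreover have "\<forall>\<^sub>F n in sequentially. snd (e n) < c"
      using order_tendstoD(2)[OF lim(2) c(1)] .
    ultimately have "\<forall>\<^sub>F n::nat in sequentially. False"
    proof eventually_elim
      case (elim n)
      have "f (fst (e n)) \<le> ereal (snd (e n))"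
        using e[rule_format, of n] by (simp add: epi_def case_prod_unfold)
      with elim(1) have "ereal c < ereal (snd (e n))" by (rule less_le_trans)
      with elim(2) show False by simp
    qed
    then show False by simp
  qed
  then show "a \<in> epi f" by (simp add: a)
qed

lemma convex_epi_Gamma0:
  assumes "f \<in> Gamma0"
  shows "convex (epi f)"
  unfolding convex_alt
proof (intro ballI allI impI, elim conjE)
  fix a b and s :: real
  assume ab: "a \<in> epi f" "b \<in> epi f" and s: "0 \<le> s" "s \<le> 1"
  obtain x l y m where a: "a = (x, l)" and b: "b = (y, m)" by fastforce
  have le: "f x \<le> ereal l" "f y \<le> ereal m" using ab by (auto simp: a b)
  \<comment> \<open>The convexity inequality in \<open>Gamma0\<close> covers only the open interval;
    at its ends the combination is one of the two points.\<close>
  consider "s = 0" | "s = 1" | "0 < s" "s < 1" using s by linarith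
  then show "(1 - s) *\<^sub>R a + s *\<^sub>R b \<in> epi f"
  proof cases
    case 3
    then have "f ((1 - s) *\<^sub>R x + s *\<^sub>R y) \<le> ereal (1 - s) * f x + ereal s * f y"
      using assms by (simp add: Gamma0_def)
    also have "\<dots> \<le> ereal (1 - s) * ereal l + ereal s * ereal m"
      using le 3 by (intro add_mono ereal_mult_left_mono) auto
    finally show ?thesis by (simp add: a b)
  qed (use ab in auto)
qed

text \<open>A far point is pulled towards \<open>(x0, l0)\<close> until its base point is at
  distance \<open>r\<close> from \<open>x0\<close>, where \<open>c\<close> bounds the height;
  convexity then limits the descent along the segment. The constant depends only on
  \<open>l0\<close>, \<open>c\<close> and \<open>r\<close>, so it can serve a whole sequence of
  epigraphs.\<close>

lemma convex_epigraph_minorant: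
  fixes E :: "('h::real_inner \<times> real) set"
  assumes "convex E" "(x0, l0) \<in> E" "r > 0"
    and near: "\<And>y m. (y, m) \<in> E \<Longrightarrow> norm (y - x0) \<le> r \<Longrightarrow> c \<le> m"
    and "(y, m) \<in> E"
  shows "- (\<bar>l0\<bar> + \<bar>c\<bar> + \<bar>l0 - c\<bar> / r) * (1 + norm (y - x0)) \<le> m"
proof -
  define K where "K = \<bar>l0\<bar> + \<bar>c\<bar> + \<bar>l0 - c\<bar> / r"
  have K: "\<bar>c\<bar> \<le> K" "\<bar>l0\<bar> \<le> K" "\<bar>l0 - c\<bar> / r \<le> K"
    using \<open>r > 0\<close> by (auto simp: K_def)
  have "K \<ge> 0" using K(1) by linarith
  have "- K * (1 + norm (y - x0)) \<le> m"
  proof (cases "norm (y - x0) \<le> r")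
    case True
    have "K \<le> K * (1 + norm (y - x0))"
      using \<open>K \<ge> 0\<close> by (simp add: distrib_left)
    with near[OF \<open>(y, m) \<in> E\<close> True] K show ?thesis by simp
  next
    case False
    define d where "d = norm (y - x0)"
    define s where "s = r / d"
    have d: "d > r" "d > 0" using False \<open>r > 0\<close> by (auto simp: d_def)
    have s: "0 < s" "s < 1" "s * d = r" using d \<open>r > 0\<close> by (auto simp: s_def)
    have "((1 - s) *\<^sub>R x0 + s *\<^sub>R y, (1 - s) * l0 + s * m) \<in> E"
      using convexD[OF \<open>convex E\<close> \<open>(x0, l0) \<in> E\<close> \<open>(y, m) \<in> E\<close>, of "1 - s" s] s by simp
    moreover have "norm (((1 - s) *\<^sub>R x0 + s *\<^sub>R y) - x0) = r"
    proof -
      have "((1 - s) *\<^sub>R x0 + s *\<^sub>R y) - x0 = s *\<^sub>R (y - x0)" by (simp add: algebra_simps)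
      then show ?thesis using s by (simp add: d_def)
    qed
    ultimately have "c \<le> (1 - s) * l0 + s * m" using near by simp
    then have "s * (l0 - m) \<le> l0 - c" by (simp add: algebra_simps)
    then have "l0 - m \<le> (l0 - c) / s" using s by (simp add: field_simps)
    also have "\<dots> = (l0 - c) / r * d" using \<open>r > 0\<close> d by (simp add: s_def)
    also have "\<dots> \<le> \<bar>l0 - c\<bar> / r * d"
      using \<open>r > 0\<close> d by (intro mult_right_mono divide_right_mono) auto
    also have "\<dots> \<le> K * d"
      using K(3) d by (intro mult_right_mono) auto
    finally show ?thesis using K(2) by (simp add: d_def[symmetric] algebra_simps)
  qed
  then show ?thesis by (simp add: K_def)
qed

text \<open>The point \<open>(x0, l0 - 1)\<close> lies strictly below the closed epigraph, so a ball
  around it misses the epigraph, which gives the local bound to be propagated by convexity.\<close>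

lemma Gamma0_minorant:
  assumes "f \<in> Gamma0"
  obtains K where "K \<ge> 0" "\<And>y m. (y, m) \<in> epi f \<Longrightarrow> - K * (1 + norm y) \<le> m"
proof -
  obtain x0 l0 where x0: "f x0 = ereal l0" by (rule Gamma0_finite[OF assms])
  have "open (- epi f)" "(x0, l0 - 1) \<in> - epi f"
    using closed_epi_Gamma0[OF assms] x0 by auto
  then obtain r where r: "r > 0" "ball (x0, l0 - 1) r \<subseteq> - epi f"
    by (meson openE)
  \<comment> \<open>A lower height could be raised to \<open>l0 - 1\<close>, giving a point of the
    epigraph inside the ball.\<close>
  have near: "l0 - 1 \<le> m" if "(y, m) \<in> epi f" "norm (y - x0) \<le> r / 2" for y m
  proof (rule ccontr)
    assume "\<not> l0 - 1 \<le> m"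
    then have "f y \<le> ereal (l0 - 1)" using that(1) order_trans[of "f y" "ereal m"] by simp
    moreover have "(y, l0 - 1) \<in> ball (x0, l0 - 1) r"
      using that(2) r(1) by (simp add: dist_Pair_Pair dist_norm norm_minus_commute)
    ultimately show False using r(2) by auto
  qed
  define K where "K = \<bar>l0\<bar> + \<bar>l0 - 1\<bar> + \<bar>l0 - (l0 - 1)\<bar> / (r / 2)"
  have "K \<ge> 0" using r(1) by (simp add: K_def)
  show ?thesis
  proof
    show "K * (1 + norm x0) \<ge> 0" using \<open>K \<ge> 0\<close> by simp
    fix y m
    assume "(y, m) \<in> epi f"
    then have "- K * (1 + norm (y - x0)) \<le> m"
      unfolding K_def using x0 r(1) near
      by (intro convex_epigraph_minorant[OF convex_epi_Gamma0[OF assms]]) auto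
    moreover have "K * (1 + norm (y - x0)) \<le> K * ((1 + norm x0) * (1 + norm y))"
    proof (rule mult_left_mono)
      have "0 \<le> norm x0 * norm y" by simp
      then show "1 + norm (y - x0) \<le> (1 + norm x0) * (1 + norm y)"
        using norm_triangle_ineq4[of y x0] unfolding distrib_left distrib_right by linarith
    qed fact
    ultimately show "- (K * (1 + norm x0)) * (1 + norm y) \<le> m" by (simp add: mult.assoc)
  qed
qed

text \<open>Properness makes \<open>f p\<close> finite on either side: test the subgradient at a
  point of finite value, or use that the supported point lies in the epigraph.\<close>

lemma subdiff_iff_supports:
  assumes "f \<in> Gamma0"
  shows "q \<in> subdiff f p \<longleftrightarrow> (\<exists>l. supports (epi f) q p l)"
proof
  assume q: "q \<in> subdiff f p"
  obtain x l where x: "f x = ereal l" by (rule Gamma0_finite[OF assms])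
  have "ereal (inner q (x - p)) \<le> f x - f p" using q by (simp add: subdiff_def)
  moreover have "f p \<noteq> -\<infinity>" using assms by (simp add: Gamma0_def)
  ultimately obtain b where b: "f p = ereal b" using x by (cases "f p") auto
  have "inner q (y - p) \<le> m - b" if "f y \<le> ereal m" for y m
  proof -
    have "ereal (inner q (y - p)) \<le> f y - f p" using q by (simp add: subdiff_def)
    also have "\<dots> \<le> ereal m - ereal b" using that b by (intro ereal_minus_mono) auto
    finally show ?thesis by simp
  qed
  with b show "\<exists>l. supports (epi f) q p l" by (auto simp: supports_def)
next
  assume "\<exists>l. supports (epi f) q p l"
  then obtain l where l: "f p \<le> ereal l" "\<And>y m. f y \<le> ereal m \<Longrightarrow> inner q (y - p) \<le> m - l"
    by (auto simp: supports_def)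
  have ninf: "f y \<noteq> -\<infinity>" for y using assms by (simp add: Gamma0_def)
  obtain b where b: "f p = ereal b" using l(1) ninf[of p] by (cases "f p") auto
  \<comment> \<open>Testing at \<open>(p, b)\<close> itself excludes a height above the value of
    \<open>f\<close>.\<close>
  have "b = l" using l(1) l(2)[of p b] b by simp
  show "q \<in> subdiff f p"
    unfolding subdiff_def
  proof (intro CollectI allI)
    fix z
    show "ereal (inner q (z - p)) \<le> f z - f p"
      using l(2)[of z] ninf[of z] b \<open>b = l\<close> by (cases "f z") auto
  qed
qed

section \<open>Existence and uniqueness for generalized proximity operators\<close>

lemma mem_prox_set_iff: "y \<in> prox_set A f x \<longleftrightarrow> x - A y \<in> subdiff f y"
  by (auto simp: prox_set_def sv_inverse_def) (metis add_diff_cancel_left' diff_add_cancel add.commute)+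

text \<open>Let \<open>P\<close> be the nonexpansive map for which
  \<open>c *\<^sub>R (y - P y)\<close> supports \<open>E\<close> at \<open>P y\<close>. A fixed
  point of \<open>y \<mapsto> P (y + (w - A y) / c)\<close> solves the problem, and for large
  \<open>c\<close> this map is a contraction, so Banach's theorem applies.\<close>

lemma strongly_monotone_supports_exists:
  fixes E :: "('h::{real_inner,complete_space} \<times> real) set"
  assumes "closed E" "convex E" "E \<noteq> {}" "K \<ge> 0"
    and minorant: "\<And>y m. (y, m) \<in> E \<Longrightarrow> - K * (1 + norm y) \<le> m"
    and "A \<in> Amaps"
  shows "\<exists>p l. supports E (w - A p) p l"
proof -
  obtain M0 \<alpha> where M0: "M0-lipschitz_on UNIV A" and \<alpha>: "strongly_monotone \<alpha> A"
    using \<open>A \<in> Amaps\<close> by (auto simp: Amaps_def)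
  \<comment> \<open>On the trivial space \<open>M0\<close> may be below \<open>\<alpha>\<close>;
    enlarging it ensures \<open>M > 0\<close> and \<open>\<alpha> / M \<le> 1\<close>, so the square
    root defining \<open>k\<close> is real.\<close>
  define M where "M = max M0 \<alpha>"
  have "\<alpha> > 0" and mono: "\<alpha> * (norm (y - x))\<^sup>2 \<le> inner (A y - A x) (y - x)" for x y
    using \<alpha> by (auto simp: strongly_monotone_def)
  then have "M > 0" "\<alpha> \<le> M" by (auto simp: M_def)
  have lip: "norm (A y - A x) \<le> M * norm (y - x)" for x y
    using lipschitz_onD[OF lipschitz_on_le[OF M0, of M]] by (simp add: M_def dist_norm)
  \<comment> \<open>This value minimises the squared contraction factor
    \<open>1 - 2 * \<alpha> / c + M^2 / c^2\<close>, with minimum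
    \<open>1 - (\<alpha> / M)^2\<close>.\<close>
  define c where "c = M\<^sup>2 / \<alpha>"
  have "c > 0" using \<open>M > 0\<close> \<open>\<alpha> > 0\<close> by (simp add: c_def)
  have "\<exists>p l. supports E (c *\<^sub>R (y - p)) p l" for y
    by (rule variational_minimizer[OF assms(1-3) \<open>c > 0\<close> \<open>K \<ge> 0\<close> minorant, where w = y])
      (auto simp: supports_def)
  then obtain P where P: "\<exists>l. supports E (c *\<^sub>R (y - P y)) (P y) l" for y by metis
  have P_nonexp: "norm (P y - P z) \<le> norm (y - z)" for y z
  proof -
    obtain l m where "supports E (c *\<^sub>R (y - P y)) (P y) l" "supports E (c *\<^sub>R (z - P z)) (P z) m"
      using P by metis
    from supports_monotone[OF this]
    have "0 \<le> c * inner ((y - z) - (P y - P z)) (P y - P z)"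
      by (simp add: algebra_simps flip: scaleR_diff_right)
    then have "norm (P y - P z) * norm (P y - P z) \<le> inner (y - z) (P y - P z)"
      using \<open>c > 0\<close> by (simp add: zero_le_mult_iff inner_diff_left[of "y - z"] flip: power2_norm_eq_inner power2_eq_square)
    also have "\<dots> \<le> norm (y - z) * norm (P y - P z)" by (rule norm_cauchy_schwarz)
    finally show ?thesis by (cases "P y = P z") auto
  qed
  define T where "T y = P (y + (1 / c) *\<^sub>R (w - A y))" for y
  define k where "k = sqrt (1 - (\<alpha> / M)\<^sup>2)"
  have "(\<alpha> / M)\<^sup>2 \<le> 1" "(\<alpha> / M)\<^sup>2 > 0"
    using \<open>\<alpha> > 0\<close> \<open>\<alpha> \<le> M\<close> \<open>M > 0\<close> by (auto simp: power_le_one_iff)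
  then have k: "0 \<le> k" "k < 1" by (auto simp: k_def)
  have "dist (T y) (T z) \<le> k * dist y z" for y z
  proof -
    define D where "D = A y - A z"
    have "dist (T y) (T z) \<le> norm ((y - z) - (1 / c) *\<^sub>R D)"
      using P_nonexp[of "y + (1 / c) *\<^sub>R (w - A y)" "z + (1 / c) *\<^sub>R (w - A z)"]
      by (simp add: T_def D_def dist_norm algebra_simps)
    moreover have "norm ((y - z) - (1 / c) *\<^sub>R D) \<le> k * norm (y - z)"
    proof (rule power2_le_imp_le)
      have "(norm ((y - z) - (1 / c) *\<^sub>R D))\<^sup>2 =
          (norm (y - z))\<^sup>2 - 2 / c * inner D (y - z) + (norm D)\<^sup>2 / c\<^sup>2"
        unfolding power2_norm_eq_inner
        by (simp add: inner_diff_left inner_diff_right inner_commute power2_eq_square diff_divide_distrib)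
      also have "\<dots> \<le> (norm (y - z))\<^sup>2 - 2 / c * (\<alpha> * (norm (y - z))\<^sup>2) + (M * norm (y - z))\<^sup>2 / c\<^sup>2"
        unfolding D_def using lip mono \<open>c > 0\<close>
        by (intro add_mono diff_mono mult_left_mono divide_right_mono power_mono) auto
      also have "\<dots> = (1 - (\<alpha> / M)\<^sup>2) * (norm (y - z))\<^sup>2"
        using \<open>\<alpha> > 0\<close> \<open>M > 0\<close> by (simp add: c_def field_simps power2_eq_square)
      also have "\<dots> = (k * norm (y - z))\<^sup>2"
        using \<open>(\<alpha> / M)\<^sup>2 \<le> 1\<close> by (simp add: k_def power_mult_distrib)
      finally show "(norm ((y - z) - (1 / c) *\<^sub>R D))\<^sup>2 \<le> (k * norm (y - z))\<^sup>2" .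
    qed (use k in auto)
    ultimately show ?thesis by (simp add: dist_norm)
  qed
  then obtain p where p: "T p = p"
    using banach_fix_type[OF k, of T] by blast
  obtain l where "supports E (c *\<^sub>R ((p + (1 / c) *\<^sub>R (w - A p)) - T p)) (T p) l"
    using P unfolding T_def by metis
  with p \<open>c > 0\<close> have "supports E (w - A p) p l" by simp
  then show ?thesis by blast
qed

text \<open>Strong monotonicity of \<open>A\<close> and monotonicity of the subdifferential give
  uniqueness, the fixed point gives existence; hence the definite description in \<open>prox\<close>
  is meaningful.\<close>

lemma prox_eq_iff:
  fixes A :: "'h::{real_inner,complete_space} \<Rightarrow> 'h"
  assumes "A \<in> Amaps" "f \<in> Gamma0"
  shows "prox A f x = y \<longleftrightarrow> x - A y \<in> subdiff f y"
proof -
  obtain \<alpha> where \<alpha>: "strongly_monotone \<alpha> A"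
    using \<open>A \<in> Amaps\<close> by (auto simp: Amaps_def)
  have unique: "y = z" if yz: "x - A y \<in> subdiff f y" "x - A z \<in> subdiff f z" for y z
  proof -
    have "0 \<le> inner ((x - A y) - (x - A z)) (y - z)"
      using yz supports_monotone unfolding subdiff_iff_supports[OF \<open>f \<in> Gamma0\<close>] by blast
    moreover have "\<alpha> * (norm (y - z))\<^sup>2 \<le> inner (A y - A z) (y - z)" "\<alpha> > 0"
      using \<alpha> by (auto simp: strongly_monotone_def)
    ultimately have "\<alpha> * (norm (y - z))\<^sup>2 \<le> 0" by (simp add: inner_diff_left)
    with \<open>\<alpha> > 0\<close> show "y = z" by (simp add: mult_le_0_iff)
  qed
  obtain K where K: "K \<ge> 0" "\<And>y m. (y, m) \<in> epi f \<Longrightarrow> - K * (1 + norm y) \<le> m"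
    by (rule Gamma0_minorant[OF \<open>f \<in> Gamma0\<close>]) blast
  have "epi f \<noteq> {}"
    using Gamma0_finite[OF \<open>f \<in> Gamma0\<close>] by (metis empty_iff mem_epi_iff order_refl)
  from strongly_monotone_supports_exists[OF closed_epi_Gamma0[OF \<open>f \<in> Gamma0\<close>]
      convex_epi_Gamma0[OF \<open>f \<in> Gamma0\<close>] this K \<open>A \<in> Amaps\<close>, of x]
  obtain p where p: "x - A p \<in> subdiff f p"
    using subdiff_iff_supports[OF \<open>f \<in> Gamma0\<close>] by blast
  have "prox A f x = p"
    unfolding prox_def mem_prox_set_iff using p unique by blast
  with p unique show ?thesis by blast
qed

subsection \<open>Lower limits of sets\<close>

lemma filterlim_at_right_0I:
  fixes t :: "nat \<Rightarrow> real"
  assumes "\<And>n. t n > 0" "t \<longlonglongrightarrow> 0"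
  shows "filterlim t (at_right 0) sequentially"
  using assms by (auto simp: filterlim_at less_imp_neq[symmetric])

text \<open>The filter form allows several limit conditions to be combined at a common
  \<open>\<tau>\<close>. Conversely, recovery sequences consist of almost nearest points of
  \<open>S (t n)\<close>.\<close>

lemma mem_set_liminf_iff:
  "x \<in> set_liminf S \<longleftrightarrow> (\<forall>\<epsilon>>0. \<forall>\<^sub>F \<tau> in at_right 0. \<exists>y\<in>S \<tau>. dist y x < \<epsilon>)"
proof (intro iffI allI impI)
  fix \<epsilon> :: real
  assume x: "x \<in> set_liminf S" and "\<epsilon> > 0"
  show "\<forall>\<^sub>F \<tau> in at_right 0. \<exists>y\<in>S \<tau>. dist y x < \<epsilon>"
  proof (rule sequentially_imp_eventually_at_right[of 0 1])
    fix t :: "nat \<Rightarrow> real"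
    assume "\<And>n. 0 < t n" "t \<longlonglongrightarrow> 0"
    then obtain X N where X: "X \<longlonglongrightarrow> x" "\<And>n. n \<ge> N \<Longrightarrow> X n \<in> S (t n)"
      using x unfolding set_liminf_def by blast
    have "\<forall>\<^sub>F n in sequentially. dist (X n) x < \<epsilon>"
      using X(1) \<open>\<epsilon> > 0\<close> by (rule tendstoD)
    then show "\<forall>\<^sub>F n in sequentially. \<exists>y\<in>S (t n). dist y x < \<epsilon>"
      using eventually_ge_at_top[of N] by eventually_elim (use X(2) in blast)
  qed simp
next
  assume *: "\<forall>\<epsilon>>0. \<forall>\<^sub>F \<tau> in at_right 0. \<exists>y\<in>S \<tau>. dist y x < \<epsilon>"
  have "\<exists>X N. X \<longlonglongrightarrow> x \<and> (\<forall>n\<ge>N. X n \<in> S (t n))" if "\<And>n. t n > 0" "t \<longlonglongrightarrow> 0" for t :: "nat \<Rightarrow> real"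
  proof -
    have ev: "\<forall>\<^sub>F n in sequentially. \<exists>y\<in>S (t n). dist y x < \<epsilon>" if "\<epsilon> > 0" for \<epsilon>
      using * that filterlim_at_right_0I[OF \<open>\<And>n. t n > 0\<close> \<open>t \<longlonglongrightarrow> 0\<close>]
      by (auto intro: eventually_compose_filterlim)
    obtain N where N: "\<And>n. n \<ge> N \<Longrightarrow> S (t n) \<noteq> {}"
      using ev[of 1] unfolding eventually_sequentially by fastforce
    \<comment> \<open>The choice is conditional because early sets may be empty, and the error term
      is there because the distance need not be attained.\<close>
    have "\<exists>y. S (t n) \<noteq> {} \<longrightarrow> y \<in> S (t n) \<and> dist x y < infdist x (S (t n)) + 1 / Suc n" for n
    proof (cases "S (t n) = {}")
      case False
      then have "(INF y\<in>S (t n). dist x y) < infdist x (S (t n)) + 1 / Suc n"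
        by (simp add: infdist_notempty)
      then show ?thesis
        using False by (subst (asm) cINF_less_iff) (auto intro: bdd_belowI2[of _ 0])
    qed simp
    then obtain X where X: "\<And>n. S (t n) \<noteq> {} \<Longrightarrow>
        X n \<in> S (t n) \<and> dist x (X n) < infdist x (S (t n)) + 1 / Suc n" by metis
    have "X \<longlonglongrightarrow> x"
    proof (rule tendstoI)
      fix \<epsilon> :: real
      assume "\<epsilon> > 0"
      have "\<forall>\<^sub>F n in sequentially. 1 / real (Suc n) < \<epsilon> / 2"
        using \<open>\<epsilon> > 0\<close> LIMSEQ_Suc[OF lim_1_over_n] by (intro order_tendstoD(2)) auto
      moreover have "\<forall>\<^sub>F n in sequentially. \<exists>y\<in>S (t n). dist y x < \<epsilon> / 2"
        using \<open>\<epsilon> > 0\<close> by (intro ev) simp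
      ultimately show "\<forall>\<^sub>F n in sequentially. dist (X n) x < \<epsilon>"
      proof eventually_elim
        case (elim n)
        then obtain y where y: "y \<in> S (t n)" "dist x y < \<epsilon> / 2" by (auto simp: dist_commute)
        then have "infdist x (S (t n)) < \<epsilon> / 2"
          using infdist_le[of y "S (t n)" x] by simp
        moreover have "dist x (X n) < infdist x (S (t n)) + 1 / Suc n"
          using X y(1) by blast
        ultimately show ?case using elim(1) by (simp add: dist_commute)
      qed
    qed
    then show ?thesis using X N by blast
  qed
  then show "x \<in> set_liminf S"
    by (auto simp: set_liminf_def)
qed

section \<open>Limits of epigraphs and of graphs\<close>

lemma epi_inject: "epi f = epi g \<longleftrightarrow> f = g"
proof
  assume *: "epi f = epi g"
  show "f = g"
  proof
    fix x
    have "f x \<le> ereal l \<longleftrightarrow> g x \<le> ereal l" for l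
      using * by (simp add: set_eq_iff)
    then have "g x \<le> f x" "f x \<le> g x" by (auto intro: ereal_le_real)
    then show "f x = g x" by simp
  qed
qed simp

text \<open>The lower limit is closed and stable under raising heights, so it is the epigraph of the
  infimum of its heights over each point. This justifies the definite description in
  \<open>fun_M_lim\<close>, even without Mosco convergence.\<close>

lemma epi_fun_M_lim: "epi (fun_M_lim f) = set_liminf (\<lambda>\<tau>. epi (f \<tau>))"
proof -
  define S where "S = set_liminf (\<lambda>\<tau>. epi (f \<tau>))"
  define g where "g x = Inf {ereal l |l. (x, l) \<in> S}" for x
  have "(x, l) \<in> S" if "g x \<le> ereal l" for x l
    unfolding S_def mem_set_liminf_iff
  proof (intro allI impI)
    fix \<epsilon> :: real
    assume "\<epsilon> > 0"
    have "g x < ereal (l + \<epsilon> / 3)"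
      using \<open>\<epsilon> > 0\<close> by (intro le_less_trans[OF that]) simp
    then obtain l' where l': "(x, l') \<in> S" "l' < l + \<epsilon> / 3"
      unfolding g_def Inf_less_iff by auto
    have "0 < \<epsilon> / 3" using \<open>\<epsilon> > 0\<close> by simp
    with l'(1) have "\<forall>\<^sub>F \<tau> in at_right 0. \<exists>e\<in>epi (f \<tau>). dist e (x, l') < \<epsilon> / 3"
      unfolding S_def mem_set_liminf_iff by blast
    then show "\<forall>\<^sub>F \<tau> in at_right 0. \<exists>e\<in>epi (f \<tau>). dist e (x, l) < \<epsilon>"
    proof eventually_elim
      case (elim \<tau>)
      then obtain y m where ym: "f \<tau> y \<le> ereal m" "dist (y, m) (x, l') < \<epsilon> / 3" by auto
      have "dist y x < \<epsilon> / 3" "dist m l' < \<epsilon> / 3"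
        using ym(2) dist_fst_le[of "(y, m)" "(x, l')"] dist_snd_le[of "(y, m)" "(x, l')"] by auto
      \<comment> \<open>The height \<open>l'\<close> may lie far below \<open>l\<close>; replacing
        \<open>m\<close> by \<open>max m l\<close> stays in the epigraph and comes close to
        \<open>l\<close>.\<close>
      then have "dist y x < \<epsilon> / 3" "dist (max m l) l < \<epsilon> / 3 + \<epsilon> / 3"
        using l'(2) \<open>\<epsilon> > 0\<close> unfolding dist_real_def by linarith+
      moreover have "dist (y, max m l) (x, l) \<le> dist y x + dist (max m l) l"
        unfolding dist_Pair_Pair by (rule sqrt_sum_squares_le_sum) auto
      ultimately have "dist (y, max m l) (x, l) < \<epsilon>" by simp
      moreover have "(y, max m l) \<in> epi (f \<tau>)"
        using ym(1) order_trans[of "f \<tau> y" "ereal m" "ereal (max m l)"] by simp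
      ultimately show ?case by blast
    qed
  qed
  moreover have "g x \<le> ereal l" if "(x, l) \<in> S" for x l
    unfolding g_def using that by (intro Inf_lower) auto
  ultimately have "epi g = S" by auto
  then have "fun_M_lim f = g"
    unfolding fun_M_lim_def S_def[symmetric] by (metis (mono_tags, lifting) epi_inject the_equality)
  with \<open>epi g = S\<close> show ?thesis by (simp add: S_def)
qed

lemma graph_of_inject: "graph_of F = graph_of G \<longleftrightarrow> F = G"
  by (auto simp: graph_of_def fun_eq_iff set_eq_iff)

lemma mem_graph_of_sv_iff: "(w, y) \<in> graph_of (sv F) \<longleftrightarrow> y = F w"
  by (auto simp: graph_of_def sv_def)

text \<open>Continuous convergence gives both that limits of graph points lie on the limit graph and
  that this graph is approximated. The upper limit, the limit graph and the lower limit therefore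
  coincide.\<close>

lemma G_convergent_if_continuous_convergence:
  assumes conv: "\<And>t W w. (\<And>n::nat. t n > 0) \<Longrightarrow> t \<longlonglongrightarrow> 0 \<Longrightarrow> W \<longlonglongrightarrow> w \<Longrightarrow>
    (\<lambda>n. Z (t n) (W n)) \<longlonglongrightarrow> Z0 w"
    and Z: "\<And>\<tau>. \<tau> > 0 \<Longrightarrow> F \<tau> = sv (Z \<tau>)"
  shows "G_convergent F \<and> G_lim F = sv Z0"
proof -
  let ?S = "\<lambda>\<tau>. graph_of (F \<tau>)"
  have mem: "e \<in> ?S \<tau> \<longleftrightarrow> snd e = Z \<tau> (fst e)" if "\<tau> > 0" for \<tau> e
    using Z[OF that] by (cases e) (simp add: mem_graph_of_sv_iff)
  have "set_limsup ?S \<subseteq> graph_of (sv Z0)"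
  proof
    fix e
    assume "e \<in> set_limsup ?S"
    then obtain t X where t: "\<And>n. t n > 0" "t \<longlonglongrightarrow> 0" and "X \<longlonglongrightarrow> e"
      and X: "\<And>n::nat. X n \<in> ?S (t n)" by (auto simp: set_limsup_def)
    have "(\<lambda>n. snd (X n)) \<longlonglongrightarrow> Z0 (fst e)"
      using conv[OF t tendsto_fst[OF \<open>X \<longlonglongrightarrow> e\<close>]] X mem[OF t(1)] by simp
    then have "snd e = Z0 (fst e)"
      using tendsto_snd[OF \<open>X \<longlonglongrightarrow> e\<close>] LIMSEQ_unique by blast
    then show "e \<in> graph_of (sv Z0)" by (cases e) (simp add: mem_graph_of_sv_iff)
  qed
  moreover have "graph_of (sv Z0) \<subseteq> set_liminf ?S"
  proof
    fix e
    assume "e \<in> graph_of (sv Z0)"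
    then obtain w where e: "e = (w, Z0 w)" by (cases e) (simp add: mem_graph_of_sv_iff)
    have "\<exists>X N. X \<longlonglongrightarrow> e \<and> (\<forall>n\<ge>N. X n \<in> ?S (t n))" if t: "\<forall>n::nat. t n > 0" "t \<longlonglongrightarrow> 0" for t
    proof (intro exI conjI)
      show "(\<lambda>n. (w, Z (t n) w)) \<longlonglongrightarrow> e"
        unfolding e using conv[of t "\<lambda>_. w"] t by (intro tendsto_Pair) auto
      show "\<forall>n\<ge>0. (w, Z (t n) w) \<in> ?S (t n)" using t mem by simp
    qed
    then show "e \<in> set_liminf ?S" by (auto simp: set_liminf_def)
  qed
  \<comment> \<open>One positive null sequence suffices; it is shifted by \<open>N\<close> because
    the upper limit demands membership for every index.\<close>
  moreover have "set_liminf ?S \<subseteq> set_limsup ?S"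
  proof
    fix e
    assume e: "e \<in> set_liminf ?S"
    define t :: "nat \<Rightarrow> real" where "t n = 1 / Suc n" for n
    have t: "\<And>n. t n > 0" "t \<longlonglongrightarrow> 0"
      using LIMSEQ_Suc[OF lim_1_over_n] unfolding t_def by simp_all
    then obtain X N where X: "X \<longlonglongrightarrow> e" "\<And>n. n \<ge> N \<Longrightarrow> X n \<in> ?S (t n)"
      using e unfolding set_liminf_def by blast
    show "e \<in> set_limsup ?S"
      unfolding set_limsup_def
      using t(1) X(2) LIMSEQ_ignore_initial_segment[OF t(2), of N]
        LIMSEQ_ignore_initial_segment[OF X(1), of N]
      by (intro CollectI exI[of _ "\<lambda>n. t (n + N)"] exI[of _ "\<lambda>n. X (n + N)"]) auto
  qed
  ultimately have "set_liminf ?S = graph_of (sv Z0)" "PK_convergent ?S"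
    by (auto simp: PK_convergent_def)
  then show ?thesis
    by (auto simp: G_convergent_def G_lim_def graph_of_inject)
qed

subsection \<open>Stability of strongly monotone variational inequalities\<close>

text \<open>The indices need only diverge, so \<open>r k \<ge> k\<close> is enough. The property may
  vary with \<open>k\<close>, which allows shrinking tolerances.\<close>

lemma subsequence_if_frequently:
  assumes "\<And>k. \<exists>\<^sub>F n in sequentially. P k n"
  shows "\<exists>r. filterlim r at_top sequentially \<and> (\<forall>k. P k (r k))"
proof -
  have "\<exists>n\<ge>k. P k n" for k using assms[of k] by (auto simp: frequently_sequentially)
  then obtain r where r: "\<And>k. k \<le> r k" "\<And>k. P k (r k)" by metis
  have "filterlim r at_top sequentially"
    by (rule filterlim_at_top_mono[OF filterlim_ident]) (use r(1) in simp)
  with r(2) show ?thesis by blast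
qed

lemma weakly_tendsto_compose:
  assumes "weakly_tendsto X x" "filterlim r at_top sequentially"
  shows "weakly_tendsto (\<lambda>k. X (r k)) x"
  using assms unfolding weakly_tendsto_def by (blast intro: filterlim_compose[where g = "\<lambda>n. inner (X n) _"])

lemma tendsto_imp_weakly_tendsto: "X \<longlonglongrightarrow> x \<Longrightarrow> weakly_tendsto X x"
  by (auto simp: weakly_tendsto_def intro: tendsto_intros)

text \<open>Here \<open>E n\<close> and \<open>F\<close> stand for the epigraphs of the quotients
  and of their limit. The assumptions \<open>wlim\<close> and \<open>recovery\<close> are the two
  halves of Mosco convergence along the sequence; constant heights suffice in \<open>wlim\<close>
  because \<open>up\<close> allows raising them. The assumption \<open>c0\<close> keeps the limit
  from being minus infinity at 0.\<close>

lemma variational_solutions_converge: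
  fixes E :: "nat \<Rightarrow> ('h::{real_inner,complete_space} \<times> real) set"
  assumes cvx: "\<And>n. convex (E n)"
    and up: "\<And>n y m m'. (y, m) \<in> E n \<Longrightarrow> m \<le> m' \<Longrightarrow> (y, m') \<in> E n"
    and zero: "\<And>n. (0, 0) \<in> E n"
    and wlim: "\<And>r y x m. filterlim r at_top sequentially \<Longrightarrow> weakly_tendsto y x \<Longrightarrow>
      (\<And>k. (y k, m) \<in> E (r k)) \<Longrightarrow> (x, m) \<in> F"
    and recovery: "\<And>u m. (u, m) \<in> F \<Longrightarrow>
      \<exists>U \<Lambda>. U \<longlonglongrightarrow> u \<and> \<Lambda> \<longlonglongrightarrow> m \<and> (\<forall>\<^sub>F n in sequentially. (U n, \<Lambda> n) \<in> E n)"
    and c0: "(0, c0) \<notin> F"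
    and "\<alpha> > 0"
    and mono: "\<And>n x y. \<alpha> * (norm (y - x))\<^sup>2 \<le> inner (B n y - B n x) (y - x)"
    and cont: "\<And>U u. U \<longlonglongrightarrow> u \<Longrightarrow> (\<lambda>n. B n (U n)) \<longlonglongrightarrow> B' u"
    and W: "W \<longlonglongrightarrow> w"
    and sol: "\<And>n. supports (E n) (W n - B n (z n)) (z n) (l n)"
    and lim: "supports F (w - B' p) p b"
  shows "z \<longlonglongrightarrow> p"
proof -
  define q where "q = w - B' p"
  obtain U \<Lambda> where U: "U \<longlonglongrightarrow> p" and \<Lambda>: "\<Lambda> \<longlonglongrightarrow> b"
    and UE: "\<forall>\<^sub>F n in sequentially. (U n, \<Lambda> n) \<in> E n"
    using recovery lim unfolding supports_def by blast
  define G where "G n = W n - B n (U n)" for n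
  have G: "G \<longlonglongrightarrow> q"
    unfolding G_def q_def by (intro tendsto_intros W cont U)
  have zE: "(z n, l n) \<in> E n" for n using sol by (simp add: supports_def)
  \<comment> \<open>Test the inclusion against the recovery point. Strong monotonicity trades
    \<open>B n (z n)\<close> for \<open>B n (U n)\<close>, whose limit is known, and yields the
    quadratic term.\<close>
  have energy: "\<forall>\<^sub>F n in sequentially.
      \<alpha> * (norm (z n - U n))\<^sup>2 \<le> inner (G n) (z n - U n) + \<Lambda> n - l n"
    using UE
  proof eventually_elim
    case (elim n)
    then have "inner (W n - B n (z n)) (U n - z n) \<le> \<Lambda> n - l n"
      using sol[of n] by (simp add: supports_def)
    with mono[of "z n" "U n" n] show ?case
      by (simp add: G_def inner_diff_left inner_diff_right)
  qed
  \<comment> \<open>Otherwise there are points tending to 0 with heights below \<open>c0\<close>;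
    raised to \<open>c0\<close>, they would put \<open>(0, c0)\<close> into
    \<open>F\<close>.\<close>
  obtain \<rho> where "\<rho> > 0" and \<rho>: "\<forall>\<^sub>F n in sequentially. \<forall>y m. (y, m) \<in> E n \<longrightarrow> norm y \<le> \<rho> \<longrightarrow> c0 \<le> m"
  proof (rule ccontr)
    assume "\<not> thesis"
    then have none: "\<not> (\<forall>\<^sub>F n in sequentially. \<forall>y m. (y, m) \<in> E n \<longrightarrow> norm y \<le> 1 / Suc k \<longrightarrow> c0 \<le> m)" for k
      using that[of "1 / Suc k"] by (auto simp del: of_nat_Suc)
    define Q where "Q k n \<longleftrightarrow> (\<exists>y m. (y, m) \<in> E n \<and> norm y \<le> 1 / Suc k \<and> m < c0)" for k n
    have "\<exists>\<^sub>F n in sequentially. Q k n" for k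
      using none[of k] unfolding not_eventually Q_def
      by (rule frequently_mono[rotated]) (auto simp: not_le)
    then obtain r where r: "filterlim r at_top sequentially" "\<And>k. Q k (r k)"
      using subsequence_if_frequently[of Q] by blast
    have "\<exists>y. (y, c0) \<in> E (r k) \<and> norm y \<le> 1 / Suc k" for k
    proof -
      obtain y m where "(y, m) \<in> E (r k)" "norm y \<le> 1 / Suc k" "m < c0"
        using r(2)[of k] unfolding Q_def by blast
      then show ?thesis using up[of y m "r k" c0] by auto
    qed
    then obtain y where y: "\<And>k. (y k, c0) \<in> E (r k)" "\<And>k. norm (y k) \<le> 1 / Suc k"
      by metis
    have "y \<longlonglongrightarrow> 0"
      by (rule Lim_null_comparison[OF _ LIMSEQ_Suc[OF lim_1_over_n]]) (use y in auto)
    then show False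
      using wlim[OF r(1) tendsto_imp_weakly_tendsto y(1)] c0 by blast
  qed
  \<comment> \<open>The constant of \<open>convex_epigraph_minorant\<close> at the common point
    \<open>(0, 0)\<close>; it is independent of \<open>n\<close>.\<close>
  define K where "K = \<bar>0\<bar> + \<bar>c0\<bar> + \<bar>0 - c0\<bar> / \<rho>"
  have "K \<ge> 0" using \<open>\<rho> > 0\<close> by (simp add: K_def)
  have minorant: "\<forall>\<^sub>F n in sequentially. - K * (1 + norm (z n)) \<le> l n"
    using \<rho>
  proof eventually_elim
    case (elim n)
    have "- K * (1 + norm (z n - 0)) \<le> l n"
      unfolding K_def
      by (rule convex_epigraph_minorant[OF cvx zero \<open>\<rho> > 0\<close> _ zE]) (use elim in auto)
    then show ?case by simp
  qed
  obtain g where g: "\<And>n. norm (G n) \<le> g"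
    using G by (metis BseqE convergentI convergent_imp_Bseq)
  obtain \<kappa> where \<kappa>: "\<And>n. norm (U n) \<le> \<kappa>"
    using U by (metis BseqE convergentI convergent_imp_Bseq)
  obtain L where L: "\<And>n. \<bar>\<Lambda> n\<bar> \<le> L"
    using \<Lambda> by (metis BseqE convergentI convergent_imp_Bseq real_norm_def)
  have nonneg: "g \<ge> 0" "\<kappa> \<ge> 0" "L \<ge> 0"
    using g[of 0] \<kappa>[of 0] L[of 0] norm_ge_zero[of "G 0"] norm_ge_zero[of "U 0"] by linarith+
  define \<beta> where "\<beta> = L + K + K * \<kappa>"
  have "\<beta> \<ge> 0" using nonneg \<open>K \<ge> 0\<close> by (simp add: \<beta>_def)
  \<comment> \<open>With \<open>d = |z n - U n|\<close>, the energy estimate becomes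
    \<open>\<alpha> * d^2 \<le> (g + K) * d + \<beta>\<close>. Either \<open>d \<le> 1\<close>, or
    \<open>\<beta> \<le> \<beta> * d\<close> and one factor \<open>d\<close> cancels.\<close>
  define R where "R = 1 + (g + K + \<beta>) / \<alpha> + \<kappa>"
  have "\<forall>\<^sub>F n in sequentially. norm (z n) \<le> R"
    using minorant energy
  proof eventually_elim
    case (elim n)
    define d where "d = norm (z n - U n)"
    have z_le: "norm (z n) \<le> d + \<kappa>"
      using norm_triangle_sub[of "z n" "U n"] \<kappa>[of n] by (simp add: d_def)
    have "inner (G n) (z n - U n) \<le> g * d"
      unfolding d_def by (rule order_trans[OF norm_cauchy_schwarz]) (intro mult_right_mono g norm_ge_zero)
    moreover have "K * norm (z n) \<le> K * (d + \<kappa>)"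
      using z_le \<open>K \<ge> 0\<close> by (rule mult_left_mono)
    ultimately have quad: "\<alpha> * d\<^sup>2 \<le> (g + K) * d + \<beta>"
      using elim L[of n] by (simp add: d_def \<beta>_def algebra_simps)
    have "d \<le> 1 + (g + K + \<beta>) / \<alpha>"
    proof (cases "d \<le> 1")
      case True
      then show ?thesis using nonneg \<open>K \<ge> 0\<close> \<open>\<beta> \<ge> 0\<close> \<open>\<alpha> > 0\<close> by (simp add: add_increasing2)
    next
      case False
      then have "\<beta> * 1 \<le> \<beta> * d" using \<open>\<beta> \<ge> 0\<close> by (intro mult_left_mono) auto
      with quad have "d * (\<alpha> * d) \<le> d * (g + K + \<beta>)"
        by (simp add: algebra_simps power2_eq_square)
      with False have "\<alpha> * d \<le> g + K + \<beta>" by simp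
      with \<open>\<alpha> > 0\<close> show ?thesis by (simp add: field_simps)
    qed
    with z_le show ?case by (simp add: R_def)
  qed
  then obtain N where R: "\<And>n. n \<ge> N \<Longrightarrow> norm (z n) \<le> R"
    by (auto simp: eventually_sequentially)
  show ?thesis
  proof (rule ccontr)
    assume "\<not> z \<longlonglongrightarrow> p"
    then obtain \<epsilon> where "\<epsilon> > 0" and "\<exists>\<^sub>F n in sequentially. \<not> dist (z n) p < \<epsilon>"
      by (auto simp: tendsto_iff frequently_def)
    then have "\<exists>\<^sub>F n in sequentially. N \<le> n \<and> \<epsilon> \<le> dist (z n) p"
      using frequently_eventually_conj[OF _ eventually_ge_at_top[of N]] by (simp add: not_less)
    then obtain r where r: "filterlim r at_top sequentially" "\<And>k. N \<le> r k \<and> \<epsilon> \<le> dist (z (r k)) p"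
      using subsequence_if_frequently[of "\<lambda>_ n. N \<le> n \<and> \<epsilon> \<le> dist (z n) p"] by (fastforce)
    have "norm (z (r k)) \<le> R" for k using R r(2) by blast
    then obtain y s where s: "strict_mono s" and "weakly_tendsto ((\<lambda>k. z (r k)) \<circ> s) y"
      by (rule bounded_imp_weakly_convergent_subseq)
    define \<sigma> where "\<sigma> k = r (s k)" for k
    have \<sigma>: "filterlim \<sigma> at_top sequentially"
      unfolding \<sigma>_def by (rule filterlim_compose[OF r(1) filterlim_subseq[OF s]])
    have y: "weakly_tendsto (\<lambda>k. z (\<sigma> k)) y"
      using \<open>weakly_tendsto ((\<lambda>k. z (r k)) \<circ> s) y\<close> by (simp add: \<sigma>_def o_def)
    have far: "\<epsilon> \<le> dist (z (\<sigma> k)) p" "norm (z (\<sigma> k)) \<le> R" for k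
      using r(2) R by (auto simp: \<sigma>_def)
    \<comment> \<open>Far from \<open>p\<close> the quadratic term is eventually at least
      \<open>\<alpha> * (\<epsilon> / 2)^2 = 4 * \<delta>\<close>, while the two limits below bound
      it by \<open>2 * \<delta>\<close>.\<close>
    define \<delta> where "\<delta> = \<alpha> * \<epsilon>\<^sup>2 / 16"
    have "\<delta> > 0" using \<open>\<alpha> > 0\<close> \<open>\<epsilon> > 0\<close> by (simp add: \<delta>_def)
    define c where "c = inner q (y - p) + b - \<delta>"
    \<comment> \<open>Mosco lower bound: heights at most \<open>c\<close> infinitely often would put
      \<open>(y, c)\<close> into \<open>F\<close>, below the supporting functional at
      \<open>p\<close> by \<open>\<delta>\<close>.\<close>
    have "\<forall>\<^sub>F k in sequentially. c < l (\<sigma> k)"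
    proof (rule ccontr)
      assume "\<not> (\<forall>\<^sub>F k in sequentially. c < l (\<sigma> k))"
      then have "\<exists>\<^sub>F k in sequentially. l (\<sigma> k) \<le> c" by (simp add: not_eventually not_less)
      then obtain h where h: "filterlim h at_top sequentially" "\<And>k. l (\<sigma> (h k)) \<le> c"
        using subsequence_if_frequently[of "\<lambda>_ n. l (\<sigma> n) \<le> c"] by (fastforce)
      have "(y, c) \<in> F"
        by (rule wlim[OF filterlim_compose[OF \<sigma> h(1)] weakly_tendsto_compose[OF y h(1)] up[OF zE h(2)]])
      then have "inner q (y - p) \<le> c - b"
        using lim by (simp add: supports_def q_def)
      with \<open>\<delta> > 0\<close> show False by (simp add: c_def)
    qed
    moreover have "(\<lambda>k. inner (G (\<sigma> k)) (z (\<sigma> k) - U (\<sigma> k)) + \<Lambda> (\<sigma> k)) \<longlonglongrightarrow> inner q (y - p) + b"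
    proof -
      \<comment> \<open>Strong convergence of \<open>G\<close> against a bounded sequence; only the
        fixed vector \<open>q\<close> is then paired with the weakly convergent
        \<open>z\<close>.\<close>
      have "(\<lambda>k. inner (G (\<sigma> k) - q) (z (\<sigma> k) - U (\<sigma> k))) \<longlonglongrightarrow> 0"
      proof (rule Lim_null_comparison)
        have "norm (z (\<sigma> k) - U (\<sigma> k)) \<le> R + \<kappa>" for k
          using norm_triangle_ineq4[of "z (\<sigma> k)" "U (\<sigma> k)"] far(2)[of k] \<kappa>[of "\<sigma> k"] by linarith
        then have "\<bar>inner (G (\<sigma> k) - q) (z (\<sigma> k) - U (\<sigma> k))\<bar> \<le> norm (G (\<sigma> k) - q) * (R + \<kappa>)" for k
          by (rule order_trans[OF Cauchy_Schwarz_ineq2 mult_left_mono]) simp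
        then show "\<forall>\<^sub>F k in sequentially. norm (inner (G (\<sigma> k) - q) (z (\<sigma> k) - U (\<sigma> k)))
            \<le> norm (G (\<sigma> k) - q) * (R + \<kappa>)" by simp
        show "(\<lambda>k. norm (G (\<sigma> k) - q) * (R + \<kappa>)) \<longlonglongrightarrow> 0"
          using filterlim_compose[OF G \<sigma>] by (intro tendsto_mult_left_zero tendsto_norm_zero LIM_zero)
      qed
      moreover have "(\<lambda>k. inner q (z (\<sigma> k))) \<longlonglongrightarrow> inner q y"
        using y by (simp add: weakly_tendsto_def inner_commute)
      moreover have "(\<lambda>k. inner q (U (\<sigma> k))) \<longlonglongrightarrow> inner q p"
        by (intro tendsto_intros filterlim_compose[OF U \<sigma>])
      ultimately have "(\<lambda>k. inner (G (\<sigma> k) - q) (z (\<sigma> k) - U (\<sigma> k)) + inner q (z (\<sigma> k)) - inner q (U (\<sigma> k))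
          + \<Lambda> (\<sigma> k)) \<longlonglongrightarrow> 0 + inner q y - inner q p + b"
        by (intro tendsto_add tendsto_diff filterlim_compose[OF \<Lambda> \<sigma>])
      then show ?thesis by (simp add: inner_diff_left inner_diff_right)
    qed
    then have "\<forall>\<^sub>F k in sequentially.
        inner (G (\<sigma> k)) (z (\<sigma> k) - U (\<sigma> k)) + \<Lambda> (\<sigma> k) < inner q (y - p) + b + \<delta>"
      using \<open>\<delta> > 0\<close> by (intro order_tendstoD(2)) auto
    moreover have "\<forall>\<^sub>F k in sequentially. \<alpha> * (norm (z (\<sigma> k) - U (\<sigma> k)))\<^sup>2 \<le>
        inner (G (\<sigma> k)) (z (\<sigma> k) - U (\<sigma> k)) + \<Lambda> (\<sigma> k) - l (\<sigma> k)"
      using eventually_compose_filterlim[OF energy \<sigma>] .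
    moreover have "\<forall>\<^sub>F k in sequentially. dist (U (\<sigma> k)) p < \<epsilon> / 2"
      using \<open>\<epsilon> > 0\<close> by (intro tendstoD filterlim_compose[OF U \<sigma>]) simp
    ultimately have "\<forall>\<^sub>F k::nat in sequentially. False"
    proof eventually_elim
      case (elim k)
      have "\<epsilon> / 2 \<le> norm (z (\<sigma> k) - U (\<sigma> k))"
        using far(1)[of k] elim(4) dist_triangle[of "z (\<sigma> k)" p "U (\<sigma> k)"] by (simp add: dist_norm)
      then have "\<alpha> * (\<epsilon> / 2)\<^sup>2 \<le> \<alpha> * (norm (z (\<sigma> k) - U (\<sigma> k)))\<^sup>2"
        using \<open>\<epsilon> > 0\<close> \<open>\<alpha> > 0\<close> by (intro mult_left_mono power_mono) auto
      with elim have "\<alpha> * (\<epsilon> / 2)\<^sup>2 < 2 * \<delta>" by (simp add: c_def)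
      moreover have "\<alpha> * (\<epsilon> / 2)\<^sup>2 = 4 * \<delta>" by (simp add: \<delta>_def power2_eq_square)
      ultimately show False using \<open>\<delta> > 0\<close> by simp
    qed
    then show False by simp
  qed
qed

subsection \<open>Difference quotients\<close>

lemma semi_derivative_tendsto:
  assumes "semi_differentiable A v"
  shows "(semi_quotient A v \<longlongrightarrow> semi_derivative A v w) (at_right 0 \<times>\<^sub>F nhds w)"
proof -
  obtain L where L: "(semi_quotient A v \<longlongrightarrow> L) (at_right 0 \<times>\<^sub>F nhds w)"
    using assms by (auto simp: semi_differentiable_def)
  have "at_right (0::real) \<times>\<^sub>F nhds w \<noteq> bot"
    by (simp add: prod_filter_eq_bot)
  with L show ?thesis unfolding semi_derivative_def using tendsto_Lim by metis
qed

lemma semi_quotient_tendsto: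
  assumes "semi_differentiable A v" "filterlim t (at_right 0) G" "(U \<longlongrightarrow> u) G"
  shows "((\<lambda>n. semi_quotient A v (t n, U n)) \<longlongrightarrow> semi_derivative A v u) G"
  by (rule filterlim_compose[OF semi_derivative_tendsto[OF assms(1)] filterlim_Pair[OF assms(2,3)]])

text \<open>The base value \<open>A 0 v\<close> cancels, so regularity of the quotient at time
  \<open>\<tau>\<close> comes from \<open>A \<tau>\<close> alone.\<close>

lemma semi_quotient_diff:
  "semi_quotient A v (\<tau>, y) - semi_quotient A v (\<tau>, z) =
    (A \<tau> (v + \<tau> *\<^sub>R y) - A \<tau> (v + \<tau> *\<^sub>R z)) /\<^sub>R \<tau>"
  by (simp add: semi_quotient_def flip: scaleR_diff_right)

text \<open>Increments of the argument scale by \<open>\<tau>\<close> and the quotient divides by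
  \<open>\<tau>\<close>, so the constant is preserved, uniformly in \<open>\<tau>\<close>.\<close>

lemma strongly_monotone_semi_quotient:
  assumes "strongly_monotone \<alpha> (A \<tau>)" "\<tau> > 0"
  shows "strongly_monotone \<alpha> (\<lambda>w. semi_quotient A v (\<tau>, w))"
  unfolding strongly_monotone_def
proof (intro conjI allI)
  show "\<alpha> > 0" using assms by (simp add: strongly_monotone_def)
  fix y z
  have "\<alpha> * (norm ((v + \<tau> *\<^sub>R z) - (v + \<tau> *\<^sub>R y)))\<^sup>2 \<le>
      inner (A \<tau> (v + \<tau> *\<^sub>R z) - A \<tau> (v + \<tau> *\<^sub>R y)) ((v + \<tau> *\<^sub>R z) - (v + \<tau> *\<^sub>R y))"
    using assms unfolding strongly_monotone_def by blast
  moreover have "(v + \<tau> *\<^sub>R z) - (v + \<tau> *\<^sub>R y) = \<tau> *\<^sub>R (z - y)" by (simp add: algebra_simps)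
  ultimately have "\<tau> * (\<tau> * (\<alpha> * (norm (z - y))\<^sup>2)) \<le>
      \<tau> * inner (A \<tau> (v + \<tau> *\<^sub>R z) - A \<tau> (v + \<tau> *\<^sub>R y)) (z - y)"
    by (simp add: power_mult_distrib power2_eq_square mult_ac)
  then have "\<alpha> * (norm (z - y))\<^sup>2 \<le> inner (A \<tau> (v + \<tau> *\<^sub>R z) - A \<tau> (v + \<tau> *\<^sub>R y)) (z - y) / \<tau>"
    using \<open>\<tau> > 0\<close> by (simp add: pos_le_divide_eq mult_ac)
  then show "\<alpha> * (norm (z - y))\<^sup>2 \<le>
      inner (semi_quotient A v (\<tau>, z) - semi_quotient A v (\<tau>, y)) (z - y)"
    by (simp only: semi_quotient_diff inner_scaleR_left divide_inverse mult.commute)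
qed

lemma lipschitz_semi_quotient:
  assumes "M-lipschitz_on UNIV (A \<tau>)" "\<tau> > 0"
  shows "M-lipschitz_on UNIV (\<lambda>w. semi_quotient A v (\<tau>, w))"
proof (rule lipschitz_onI)
  show "0 \<le> M" using assms(1) by (rule lipschitz_on_nonneg)
  fix y z
  have "norm (A \<tau> (v + \<tau> *\<^sub>R y) - A \<tau> (v + \<tau> *\<^sub>R z)) \<le> M * norm ((v + \<tau> *\<^sub>R y) - (v + \<tau> *\<^sub>R z))"
    using lipschitz_onD[OF assms(1) UNIV_I UNIV_I] unfolding dist_norm .
  also have "(v + \<tau> *\<^sub>R y) - (v + \<tau> *\<^sub>R z) = \<tau> *\<^sub>R (y - z)" by (simp add: algebra_simps)
  finally have "norm (A \<tau> (v + \<tau> *\<^sub>R y) - A \<tau> (v + \<tau> *\<^sub>R z)) / \<tau> \<le> M * norm (y - z)"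
    using \<open>\<tau> > 0\<close> by (simp add: pos_divide_le_eq mult_ac)
  then show "dist (semi_quotient A v (\<tau>, y)) (semi_quotient A v (\<tau>, z)) \<le> M * dist y z"
    using \<open>\<tau> > 0\<close>
    by (simp only: dist_norm semi_quotient_diff norm_scaleR divide_inverse) (simp add: mult.commute)
qed

text \<open>The uniform constants survive the limit along fixed directions. This makes the limiting
  proximity operator well defined.\<close>

lemma semi_derivative_Amaps:
  assumes "A \<in> Amaps_unif" "semi_differentiable A v"
  shows "semi_derivative A v \<in> Amaps"
proof -
  obtain M \<alpha> where A: "\<And>t. t \<ge> 0 \<Longrightarrow> M-lipschitz_on UNIV (A t)"
    "\<And>t. t \<ge> 0 \<Longrightarrow> strongly_monotone \<alpha> (A t)"
    using \<open>A \<in> Amaps_unif\<close> by (auto simp: Amaps_unif_def)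
  have lim: "((\<lambda>\<tau>. semi_quotient A v (\<tau>, w)) \<longlongrightarrow> semi_derivative A v w) (at_right 0)" for w
    using semi_quotient_tendsto[OF assms(2) filterlim_ident tendsto_const] .
  have "M-lipschitz_on UNIV (semi_derivative A v)"
  proof (rule lipschitz_onI)
    show "0 \<le> M" using A(1)[of 0] lipschitz_on_nonneg by blast
    fix y z
    show "dist (semi_derivative A v y) (semi_derivative A v z) \<le> M * dist y z"
    proof (rule tendsto_upperbound[OF tendsto_dist[OF lim lim]])
      show "\<forall>\<^sub>F \<tau> in at_right 0. dist (semi_quotient A v (\<tau>, y)) (semi_quotient A v (\<tau>, z)) \<le> M * dist y z"
        using eventually_at_right_less
        by eventually_elim (use lipschitz_onD[OF lipschitz_semi_quotient[OF A(1)]] in auto)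
    qed simp
  qed
  moreover have "strongly_monotone \<alpha> (semi_derivative A v)"
    unfolding strongly_monotone_def
  proof (intro conjI allI)
    show "\<alpha> > 0" using A(2)[of 0] by (simp add: strongly_monotone_def)
    fix y z
    show "\<alpha> * (norm (z - y))\<^sup>2 \<le> inner (semi_derivative A v z - semi_derivative A v y) (z - y)"
    proof (rule tendsto_lowerbound[OF tendsto_inner[OF tendsto_diff[OF lim lim] tendsto_const]])
      show "\<forall>\<^sub>F \<tau> in at_right 0. \<alpha> * (norm (z - y))\<^sup>2 \<le>
          inner (semi_quotient A v (\<tau>, z) - semi_quotient A v (\<tau>, y)) (z - y)"
        using eventually_at_right_less
        by eventually_elim
          (use strongly_monotone_semi_quotient[OF A(2)] in \<open>auto simp: strongly_monotone_def\<close>)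
    qed simp
  qed
  ultimately show ?thesis by (auto simp: Amaps_def)
qed

section \<open>Rescaling of epigraphs and supporting functionals\<close>

context
  fixes f :: "real \<Rightarrow> 'h::real_inner \<Rightarrow> ereal" and v v0 :: 'h and \<tau> a :: real
  assumes pos: "\<tau> > 0" and a: "f \<tau> v = ereal a"
begin

text \<open>The epigraph of the quotient is the preimage of \<open>epi (f \<tau>)\<close> under an
  affine map, which transfers convexity and supporting functionals without extended-real
  division.\<close>

lemma mem_epi_epi_quotient_iff:
  "(y, m) \<in> epi (epi_quotient f v v0 \<tau>) \<longleftrightarrow>
    (v + \<tau> *\<^sub>R y, a + \<tau> * inner v0 y + \<tau>\<^sup>2 * m) \<in> epi (f \<tau>)"
proof (cases "f \<tau> (v + \<tau> *\<^sub>R y)")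
  case (real b)
  then show ?thesis
    using pos a by (simp add: epi_quotient_def field_simps)
next
  case PInf
  then show ?thesis using pos a by (simp add: epi_quotient_def)
next
  case MInf
  then show ?thesis using pos a by (simp add: epi_quotient_def)
qed

lemma convex_epi_epi_quotient:
  assumes "f \<tau> \<in> Gamma0"
  shows "convex (epi (epi_quotient f v v0 \<tau>))"
  unfolding convex_alt
proof (intro ballI allI impI, elim conjE)
  fix e e' and s :: real
  assume e: "e \<in> epi (epi_quotient f v v0 \<tau>)" "e' \<in> epi (epi_quotient f v v0 \<tau>)"
    and s: "0 \<le> s" "s \<le> 1"
  define g where "g = (\<lambda>(y, m). (v + \<tau> *\<^sub>R y, a + \<tau> * inner v0 y + \<tau>\<^sup>2 * m))"
  have mem: "u \<in> epi (epi_quotient f v v0 \<tau>) \<longleftrightarrow> g u \<in> epi (f \<tau>)" for u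
    using mem_epi_epi_quotient_iff by (cases u) (simp add: g_def)
  have "g ((1 - s) *\<^sub>R e + s *\<^sub>R e') = (1 - s) *\<^sub>R g e + s *\<^sub>R g e'"
    by (cases e; cases e') (simp add: g_def algebra_simps)
  then show "(1 - s) *\<^sub>R e + s *\<^sub>R e' \<in> epi (epi_quotient f v v0 \<tau>)"
    using convex_epi_Gamma0[OF assms] e s unfolding mem convex_alt by metis
qed

text \<open>Subtracting the linear term removes \<open>v0\<close> from the slope, and scaling by
  \<open>\<tau>\<close> in space and \<open>\<tau>^2\<close> in height turns
  \<open>\<tau> *\<^sub>R q\<close> into \<open>q\<close>. The new height inverts the affine
  map.\<close>

lemma supports_epi_quotient:
  assumes "supports (epi (f \<tau>)) (v0 + \<tau> *\<^sub>R q) (v + \<tau> *\<^sub>R z) b"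
  shows "supports (epi (epi_quotient f v v0 \<tau>)) q z ((b - a - \<tau> * inner v0 z) / \<tau>\<^sup>2)"
  unfolding supports_def
proof (intro conjI allI impI)
  show "(z, (b - a - \<tau> * inner v0 z) / \<tau>\<^sup>2) \<in> epi (epi_quotient f v v0 \<tau>)"
    unfolding mem_epi_epi_quotient_iff using assms pos by (simp add: supports_def)
  fix y m
  assume "(y, m) \<in> epi (epi_quotient f v v0 \<tau>)"
  then have "inner (v0 + \<tau> *\<^sub>R q) ((v + \<tau> *\<^sub>R y) - (v + \<tau> *\<^sub>R z)) \<le>
      a + \<tau> * inner v0 y + \<tau>\<^sup>2 * m - b"
    using assms unfolding mem_epi_epi_quotient_iff supports_def by blast
  moreover have "(v + \<tau> *\<^sub>R y) - (v + \<tau> *\<^sub>R z) = \<tau> *\<^sub>R (y - z)" by (simp add: algebra_simps)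
  ultimately have "\<tau>\<^sup>2 * inner q (y - z) \<le> \<tau>\<^sup>2 * m - (b - a - \<tau> * inner v0 z)"
    by (simp add: inner_add_left inner_diff_right algebra_simps power2_eq_square)
  then show "inner q (y - z) \<le> m - (b - a - \<tau> * inner v0 z) / \<tau>\<^sup>2"
    using pos by (simp add: field_simps)
qed

end

text \<open>Moving directions \<open>W\<close> are allowed, since G-convergence is obtained from
  continuous convergence of the quotients.\<close>

lemma Prox_difference_quotient_tendsto:
  fixes A :: "real \<Rightarrow> 'h::{real_inner, complete_space} \<Rightarrow> 'h"
  assumes "A \<in> Amaps_time"
    and "f \<in> Gamma0_time"
    and v0_def: "v0 = x - A 0 v"
    and "A \<in> Amaps_unif"
    and semi: "semi_differentiable A v"
    and epi: "twice_epi_differentiable f v v0"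
    and \<Phi>: "epi_derivative2 f v v0 \<in> Gamma0"
    and t: "\<And>n::nat. t n > 0" "t \<longlonglongrightarrow> 0" and W: "W \<longlonglongrightarrow> w"
  shows "(\<lambda>n. (Prox A f (t n) (x + t n *\<^sub>R W n) - v) /\<^sub>R t n) \<longlonglongrightarrow>
    prox (semi_derivative A v) (epi_derivative2 f v v0) w"
proof -
  obtain \<alpha> where \<alpha>: "\<And>t. t \<ge> 0 \<Longrightarrow> strongly_monotone \<alpha> (A t)"
    using \<open>A \<in> Amaps_unif\<close> by (auto simp: Amaps_unif_def)
  define \<phi> where "\<phi> = epi_quotient f v v0"
  define z where "z n = (Prox A f (t n) (x + t n *\<^sub>R W n) - v) /\<^sub>R t n" for n
  define B where "B n y = semi_quotient A v (t n, y)" for n y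
  define p where "p = prox (semi_derivative A v) (epi_derivative2 f v v0) w"
  have t_right: "filterlim t (at_right 0) sequentially"
    using t by (rule filterlim_at_right_0I)
  have f: "f \<tau> \<in> Gamma0" "A \<tau> \<in> Amaps" if "\<tau> \<ge> 0" for \<tau>
    using assms(1,2) that by (auto simp: Gamma0_time_def Amaps_time_def)
  have "\<exists>a. f (t n) v = ereal a" for n
  proof -
    have "\<bar>f (t n) v\<bar> \<noteq> \<infinity>"
      using epi t(1)[of n] by (simp add: twice_epi_differentiable_def finite_domain_def)
    then show ?thesis by (cases "f (t n) v") auto
  qed
  then obtain a where a: "\<And>n. f (t n) v = ereal (a n)" by metis
  note epi_quotient_facts = mem_epi_epi_quotient_iff[where f = f and v = v, OF t(1) a] convex_epi_epi_quotient[where f = f and v = v, OF t(1) a]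
    supports_epi_quotient[where f = f and v = v, OF t(1) a]
  have \<Phi>_epi: "epi (epi_derivative2 f v v0) = set_liminf (\<lambda>\<tau>. epi (\<phi> \<tau>))"
    unfolding epi_derivative2_def \<phi>_def by (rule epi_fun_M_lim)
  have wlimsup: "set_wlimsup (\<lambda>\<tau>. epi (\<phi> \<tau>)) \<subseteq> set_liminf (\<lambda>\<tau>. epi (\<phi> \<tau>))"
    using epi by (simp add: twice_epi_differentiable_def fun_M_convergent_def M_convergent_def \<phi>_def)
  have "\<exists>l. supports (epi (\<phi> (t n))) (W n - B n (z n)) (z n) l" for n
  proof -
    define y where "y = Prox A f (t n) (x + t n *\<^sub>R W n)"
    have y: "y = v + t n *\<^sub>R z n" using t(1)[of n] by (simp add: y_def z_def)
    have "x + t n *\<^sub>R W n - A (t n) y \<in> subdiff (f (t n)) y"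
      using prox_eq_iff[OF f(2)[OF less_imp_le[OF t(1)]] f(1)[OF less_imp_le[OF t(1)]], THEN iffD1]
      by (simp add: y_def Prox_def)
    \<comment> \<open>Substituting \<open>x = v0 + A 0 v\<close> leaves an increment of
      \<open>A\<close>, which is \<open>t n\<close> times its quotient at
      \<open>z n\<close>.\<close>
    moreover have "x + t n *\<^sub>R W n - A (t n) y = v0 + t n *\<^sub>R (W n - B n (z n))"
      using t(1)[of n] by (simp add: B_def semi_quotient_def y v0_def algebra_simps)
    ultimately obtain b where "supports (epi (f (t n))) (v0 + t n *\<^sub>R (W n - B n (z n))) (v + t n *\<^sub>R z n) b"
      using subdiff_iff_supports[OF f(1)[OF less_imp_le[OF t(1)]]] y by metis
    then show ?thesis unfolding \<phi>_def using epi_quotient_facts(3) by blast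
  qed
  then obtain l where sol: "\<And>n. supports (epi (\<phi> (t n))) (W n - B n (z n)) (z n) (l n)" by metis
  obtain b where lim: "supports (epi (epi_derivative2 f v v0)) (w - semi_derivative A v p) p b"
    using prox_eq_iff[OF semi_derivative_Amaps[OF \<open>A \<in> Amaps_unif\<close> semi] \<Phi>, of w p]
      subdiff_iff_supports[OF \<Phi>] by (auto simp: p_def)
  \<comment> \<open>Properness of the second-order epi-derivative leaves room below its value at
    0.\<close>
  obtain c0 where c0: "(0, c0) \<notin> epi (epi_derivative2 f v v0)"
  proof (cases "epi_derivative2 f v v0 0")
    case (real c)
    then show ?thesis by (intro that[of "c - 1"]) simp
  next
    case PInf
    then show ?thesis by (intro that[of 0]) simp
  next
    case MInf
    then show ?thesis using \<Phi> by (simp add: Gamma0_def)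
  qed
  have "z \<longlonglongrightarrow> p"
  proof (rule variational_solutions_converge[where E = "\<lambda>n. epi (\<phi> (t n))" and B = B and \<alpha> = \<alpha>
        and F = "epi (epi_derivative2 f v v0)" and B' = "semi_derivative A v" and W = W and z = z
        and w = w and p = p and b = b and ?c0.0 = c0 and l = l])
    show "convex (epi (\<phi> (t n)))" for n
      unfolding \<phi>_def using epi_quotient_facts(2) f(1) t(1) less_imp_le by blast
    show "(y, m') \<in> epi (\<phi> (t n))" if "(y, m) \<in> epi (\<phi> (t n))" "m \<le> m'" for n y m m'
      using that order_trans[of "\<phi> (t n) y" "ereal m" "ereal m'"] by simp
    show "(0, 0) \<in> epi (\<phi> (t n))" for n
      unfolding \<phi>_def epi_quotient_facts(1) using a by simp
    show "(y, m) \<in> epi (epi_derivative2 f v v0)"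
      if r: "filterlim r at_top sequentially" and Y: "weakly_tendsto Y y"
        and mem: "\<And>k. (Y k, m) \<in> epi (\<phi> (t (r k)))" for r Y y m
    proof -
      have "weakly_tendsto (\<lambda>k. (Y k, m)) (y, m)"
        unfolding weakly_tendsto_def
      proof
        fix u :: "'h \<times> real"
        show "(\<lambda>k. inner (Y k, m) u) \<longlonglongrightarrow> inner (y, m) u"
          using Y by (cases u) (auto simp: weakly_tendsto_def intro: tendsto_add)
      qed
      moreover have "(\<lambda>k. t (r k)) \<longlonglongrightarrow> 0"
        by (rule filterlim_compose[OF t(2) r])
      ultimately have "(y, m) \<in> set_wlimsup (\<lambda>\<tau>. epi (\<phi> \<tau>))"
        unfolding set_wlimsup_def using t(1) mem
        by (intro CollectI exI[of _ "\<lambda>k. t (r k)"] exI[of _ "\<lambda>k. (Y k, m)"]) auto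
      then show ?thesis using wlimsup \<Phi>_epi by blast
    qed
    show "\<exists>U \<Lambda>. U \<longlonglongrightarrow> u \<and> \<Lambda> \<longlonglongrightarrow> m \<and> (\<forall>\<^sub>F n in sequentially. (U n, \<Lambda> n) \<in> epi (\<phi> (t n)))"
      if um: "(u, m) \<in> epi (epi_derivative2 f v v0)" for u m
    proof -
      obtain X N where X: "X \<longlonglongrightarrow> (u, m)" "\<And>n. n \<ge> N \<Longrightarrow> X n \<in> epi (\<phi> (t n))"
        using um t unfolding \<Phi>_epi set_liminf_def by blast
      have "\<forall>\<^sub>F n in sequentially. (fst (X n), snd (X n)) \<in> epi (\<phi> (t n))"
        using eventually_ge_at_top[of N] by eventually_elim (use X(2) in simp)
      then show ?thesis
        using tendsto_fst[OF X(1)] tendsto_snd[OF X(1)]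
        by (intro exI[of _ "\<lambda>n. fst (X n)"] exI[of _ "\<lambda>n. snd (X n)"]) simp
    qed
    show "\<alpha> > 0" using \<alpha>[of 0] by (simp add: strongly_monotone_def)
    show "\<alpha> * (norm (y - x))\<^sup>2 \<le> inner (B n y - B n x) (y - x)" for n x y
      using strongly_monotone_semi_quotient[where v = v and A = A, OF \<alpha>[OF less_imp_le[OF t(1)]] t(1)]
      unfolding B_def strongly_monotone_def by blast
    show "(\<lambda>n. B n (U n)) \<longlonglongrightarrow> semi_derivative A v u" if "U \<longlonglongrightarrow> u" for U u
      unfolding B_def by (rule semi_quotient_tendsto[OF semi t_right that])
  qed (fact c0 W sol lim)+
  then show ?thesis by (simp add: z_def[abs_def] p_def)
qed

theorem theorem41:
  fixes A :: "real \<Rightarrow> 'h::{real_inner, complete_space} \<Rightarrow> 'h"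
    and f :: "real \<Rightarrow> 'h \<Rightarrow> ereal"
    and x v v0 :: 'h
  assumes "A \<in> Amaps_time"
    and "f \<in> Gamma0_time"
    and v_def: "v = Prox A f 0 x"
    and v0_def: "v0 = x - A 0 v"
    and "A \<in> Amaps_unif"
    and "semi_differentiable A v"
    and "twice_epi_differentiable f v v0"
    and "epi_derivative2 f v v0 \<in> Gamma0"
  shows "proto_differentiable (\<lambda>t. sv (Prox A f t)) x v \<and>
         proto_derivative (\<lambda>t. sv (Prox A f t)) x v =
           sv (prox (semi_derivative A v) (epi_derivative2 f v v0))"
proof -
  have "G_convergent (proto_quotient (\<lambda>t. sv (Prox A f t)) x v) \<and>
      G_lim (proto_quotient (\<lambda>t. sv (Prox A f t)) x v) =
        sv (prox (semi_derivative A v) (epi_derivative2 f v v0))"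
  proof (rule G_convergent_if_continuous_convergence)
    show "proto_quotient (\<lambda>t. sv (Prox A f t)) x v \<tau> =
        sv (\<lambda>w. (Prox A f \<tau> (x + \<tau> *\<^sub>R w) - v) /\<^sub>R \<tau>)" for \<tau>
      by (simp add: proto_quotient_def sv_def fun_eq_iff)
  qed (rule Prox_difference_quotient_tendsto[OF assms(1,2,4-8)])
  moreover have "v \<in> sv (Prox A f 0) x" by (simp add: sv_def v_def)
  ultimately show ?thesis by (simp add: proto_differentiable_def proto_derivative_def)
qed

end
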